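(* For every positive integer $n$ there exists a convex body $K\subset\mathbb{E}^n$ of constant width satisfying $$I(K)\ge(\cos(\pi/14)+o(1))^{-n},$$ where $o(1)$ denotes a quantity depending only on $n$ that tends to $0$ as $n\to\infty$.
   Context: $\mathbb{E}^n$ is the $n$-dimensional Euclidean space and $\mathbb{S}^{n-1}=\{x\in\mathbb{E}^n:\|x\|=1\}$ is its unit sphere. A convex body in $\mathbb{E}^n$ is a convex compact set with non-empty interior; $\partial K$ denotes the boundary of $K$. A point $x\in\partial K$ is illuminated by a direction $\xi\in\mathbb{S}^{n-1}$ if the half-line $\{x+t\xi:t\ge 0\}$ contains an interior point of $K$. The illumination number $I(K)$ is the minimal number of directions in $\mathbb{S}^{n-1}$ such that every point $x\in\partial K$ is illuminated by at least one of them. A convex body $K$ is of constant width $d$ if the distance between any two distinct parallel supporting hyperplanes of $K$ is $d$; it is of constant width if it is of constant width $d$ for some $d$. *)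

theory Defs
  imports "HOL-Analysis.Analysis"
begin

(* The dimension n has to be a term, so that a sequence o(1) can be chosen uniformly in n.
   We therefore work on the carrier of the library's abstract topology Euclidean_space n:
   vectors are functions x :: nat => real with x i = 0 for all i >= n. *)

abbreviation E_space :: "nat \<Rightarrow> (nat \<Rightarrow> real) set" where
  "E_space n \<equiv> topspace (Euclidean_space n)"

definition E_inner :: "nat \<Rightarrow> (nat \<Rightarrow> real) \<Rightarrow> (nat \<Rightarrow> real) \<Rightarrow> real" where
  "E_inner n x y = (\<Sum>i<n. x i * y i)"

definition E_norm :: "nat \<Rightarrow> (nat \<Rightarrow> real) \<Rightarrow> real" where
  "E_norm n x = L2_set x {..<n}"

definition E_dist :: "nat \<Rightarrow> (nat \<Rightarrow> real) \<Rightarrow> (nat \<Rightarrow> real) \<Rightarrow> real" where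
  "E_dist n x y = E_norm n (\<lambda>i. x i - y i)"

definition unit_sphere :: "nat \<Rightarrow> (nat \<Rightarrow> real) set" where
  "unit_sphere n = {x \<in> E_space n. E_norm n x = 1}"

lemma E_metric: "Metric_space (E_space n) (E_dist n)"
proof
  show "0 \<le> E_dist n x y" for x y
    by (simp add: E_dist_def E_norm_def)
  show "E_dist n x y = E_dist n y x" for x y
    by (simp add: E_dist_def E_norm_def L2_set_def power2_commute)
  fix x y assume x: "x \<in> E_space n" and y: "y \<in> E_space n"
  show "(E_dist n x y = 0) = (x = y)"
  proof
    assume "E_dist n x y = 0"
    then have "x i = y i" if "i < n" for i
      using that by (simp add: E_dist_def E_norm_def L2_set_eq_0_iff)
    moreover have "x i = y i" if "i \<ge> n" for i
      using that x y by (simp add: topspace_Euclidean_space)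
    ultimately show "x = y" by (metis ext not_less)
  qed (simp add: E_dist_def E_norm_def L2_set_eq_0_iff)
next
  fix x y z
  show "E_dist n x z \<le> E_dist n x y + E_dist n y z"
    using L2_set_triangle_ineq[of "\<lambda>i. x i - y i" "\<lambda>i. y i - z i" "{..<n}"]
    by (simp add: E_dist_def E_norm_def)
qed

(* The library topology is the one induced by the Euclidean distance. *)
lemma E_mtopology: "Metric_space.mtopology (E_space n) (E_dist n) = Euclidean_space n"
proof -
  interpret Metric_space "E_space n" "E_dist n" by (rule E_metric)
  have coord: "\<bar>x i - y i\<bar> \<le> E_dist n x y" if "x \<in> E_space n" "y \<in> E_space n" for x y i
  proof (cases "i < n")
    case True
    have "L2_set (\<lambda>i. x i - y i) {..<n} = L2_set (\<lambda>i. \<bar>x i - y i\<bar>) {..<n}"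
      by (simp add: L2_set_def)
    with True show ?thesis
      using member_le_L2_set[of "{..<n}" i "\<lambda>i. \<bar>x i - y i\<bar>"]
      by (simp add: E_dist_def E_norm_def)
  next
    case False
    with that have "x i = 0" "y i = 0" by (auto simp: topspace_Euclidean_space)
    then show ?thesis by simp
  qed
  have "continuous_map mtopology euclideanreal (\<lambda>x. x i)" for i
    unfolding continuous_map_def
  proof (intro conjI allI impI)
    fix U :: "real set" assume U: "openin euclideanreal U"
    show "openin mtopology {x \<in> topspace mtopology. x i \<in> U}"
      unfolding openin_mtopology
    proof (intro conjI allI impI)
      fix x assume x: "x \<in> {x \<in> topspace mtopology. x i \<in> U}"
      then obtain e where e: "e > 0" "ball (x i) e \<subseteq> U"
        using U by (auto simp: open_contains_ball)
      have "mball x e \<subseteq> {x \<in> topspace mtopology. x i \<in> U}"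
      proof
        fix y assume y: "y \<in> mball x e"
        then have "\<bar>x i - y i\<bar> < e" using coord[of x y i] by (simp add: mball_def)
        then have "y i \<in> U" using e by (auto simp: dist_real_def)
        then show "y \<in> {x \<in> topspace mtopology. x i \<in> U}" using y by simp
      qed
      with e show "\<exists>r>0. mball x r \<subseteq> {x \<in> topspace mtopology. x i \<in> U}" by blast
    qed auto
  qed auto
  then have "continuous_map mtopology (Euclidean_space n) (\<lambda>x. x)"
    unfolding Euclidean_space_def
    by (auto simp: continuous_map_in_subtopology continuous_map_componentwise_UNIV
        topspace_Euclidean_space[symmetric])
  then have 1: "openin mtopology U" if "openin (Euclidean_space n) U" for U
  proof -
    have "{x \<in> topspace mtopology. x \<in> U} = U"
      using openin_subset[OF that] by auto
    with openin_continuous_map_preimage[OF \<open>continuous_map mtopology (Euclidean_space n) (\<lambda>x. x)\<close> that]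
    show ?thesis by simp
  qed
  have ball: "openin (Euclidean_space n) (mball x r)" if "x \<in> E_space n" for x r
  proof -
    have "continuous_on UNIV (\<lambda>y. E_dist n x y)"
      unfolding E_dist_def E_norm_def L2_set_def
      by (intro continuous_intros continuous_on_product_coordinates)
    then have "open {y. E_dist n x y < r}"
      by (intro open_Collect_less continuous_intros) auto
    moreover have "mball x r = {y. E_dist n x y < r} \<inter> {y. \<forall>i\<ge>n. y i = 0}"
      using that unfolding mball_def by (auto simp: topspace_Euclidean_space)
    ultimately show ?thesis
      unfolding Euclidean_space_def openin_subtopology euclidean_product_topology by auto
  qed
  have 2: "openin (Euclidean_space n) U" if "openin mtopology U" for U
  proof (subst openin_subopen, intro ballI)
    fix x assume "x \<in> U"
    with that obtain r where "r > 0" "mball x r \<subseteq> U" "x \<in> E_space n"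
      unfolding openin_mtopology by blast
    then show "\<exists>T. openin (Euclidean_space n) T \<and> x \<in> T \<and> T \<subseteq> U"
      using ball by (intro exI[of _ "mball x r"]) auto
  qed
  from 1 2 show ?thesis by (auto simp: topology_eq)
qed

definition E_convex :: "(nat \<Rightarrow> real) set \<Rightarrow> bool" where
  "E_convex K \<longleftrightarrow>
     (\<forall>x\<in>K. \<forall>y\<in>K. \<forall>t::real. 0 \<le> t \<and> t \<le> 1 \<longrightarrow> (\<lambda>i. (1 - t) * x i + t * y i) \<in> K)"

definition convex_body :: "nat \<Rightarrow> (nat \<Rightarrow> real) set \<Rightarrow> bool" where
  "convex_body n K \<longleftrightarrow>
     E_convex K \<and> compactin (Euclidean_space n) K \<and> Euclidean_space n interior_of K \<noteq> {}"

definition illuminates :: "nat \<Rightarrow> (nat \<Rightarrow> real) set \<Rightarrow> (nat \<Rightarrow> real) \<Rightarrow> (nat \<Rightarrow> real) \<Rightarrow> bool" where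
  "illuminates n K \<xi> x \<longleftrightarrow> (\<exists>t\<ge>0. (\<lambda>i. x i + t * \<xi> i) \<in> Euclidean_space n interior_of K)"

(* Inf on nat is the minimum of a nonempty set. Finite illuminating sets exist for every convex
   body; on junk arguments without one, the value is Inf {} = 0. *)
definition illumination_number :: "nat \<Rightarrow> (nat \<Rightarrow> real) set \<Rightarrow> nat" where
  "illumination_number n K =
     Inf {card \<Xi> |\<Xi>. finite \<Xi> \<and> \<Xi> \<subseteq> unit_sphere n \<and>
            (\<forall>x \<in> Euclidean_space n frontier_of K. \<exists>\<xi>\<in>\<Xi>. illuminates n K \<xi> x)}"

definition hyperplane :: "nat \<Rightarrow> (nat \<Rightarrow> real) \<Rightarrow> real \<Rightarrow> (nat \<Rightarrow> real) set" where
  "hyperplane n u c = {x \<in> E_space n. E_inner n u x = c}"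

(* One inequality suffices: the other half-space is obtained by replacing (u, c) with (-u, -c). *)
definition supporting_hyperplane :: "nat \<Rightarrow> (nat \<Rightarrow> real) set \<Rightarrow> (nat \<Rightarrow> real) set \<Rightarrow> bool" where
  "supporting_hyperplane n K H \<longleftrightarrow>
     (\<exists>u c. u \<in> E_space n \<and> u \<noteq> (\<lambda>_. 0) \<and> H = hyperplane n u c \<and>
            H \<inter> K \<noteq> {} \<and> (\<forall>x\<in>K. E_inner n u x \<le> c))"

definition parallel_hyperplanes :: "nat \<Rightarrow> (nat \<Rightarrow> real) set \<Rightarrow> (nat \<Rightarrow> real) set \<Rightarrow> bool" where
  "parallel_hyperplanes n H H' \<longleftrightarrow>
     (\<exists>u c c'. u \<in> E_space n \<and> u \<noteq> (\<lambda>_. 0) \<and> H = hyperplane n u c \<and> H' = hyperplane n u c')"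

definition E_setdist :: "nat \<Rightarrow> (nat \<Rightarrow> real) set \<Rightarrow> (nat \<Rightarrow> real) set \<Rightarrow> real" where
  "E_setdist n A B = Inf {E_dist n x y |x y. x \<in> A \<and> y \<in> B}"

definition constant_width_of :: "nat \<Rightarrow> (nat \<Rightarrow> real) set \<Rightarrow> real \<Rightarrow> bool" where
  "constant_width_of n K d \<longleftrightarrow>
     (\<forall>H H'. supporting_hyperplane n K H \<and> supporting_hyperplane n K H' \<and>
             parallel_hyperplanes n H H' \<and> H \<noteq> H' \<longrightarrow> E_setdist n H H' = d)"

definition constant_width :: "nat \<Rightarrow> (nat \<Rightarrow> real) set \<Rightarrow> bool" where
  "constant_width n K \<longleftrightarrow> (\<exists>d. constant_width_of n K d)"

end

theory Submission
  imports Defs "HOL-Real_Asymp.Real_Asymp"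
begin

text \<open>
  A direction illuminates a boundary point \<open>x\<close> of a convex body only if it has negative inner product
  with every outer normal at \<open>x\<close>. Suppose that the normals at \<open>x\<close> include all unit vectors that make a
  fixed angle \<open>\<phi>\<close> with an axis \<open>u\<close>. Then a direction \<open>\<xi>\<close> can illuminate \<open>x\<close> only if
  \<open>\<langle>-\<xi>, u\<rangle> \<ge> sin \<phi>\<close>, so \<open>u\<close> lies in a spherical cap of angular radius \<open>\<pi>/2 - \<phi>\<close>, which is about a
  fraction \<open>(cos \<phi>)^n\<close> of the sphere. A body that has such boundary points for a sufficiently well spread
  set \<open>U\<close> of axes therefore needs about \<open>(cos \<phi>)^(-n)\<close> directions.

  For a body of constant width 1, a unit vector \<open>v\<close> is a normal at \<open>x\<close> exactly when \<open>x - v\<close> belongs to the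
  body. So it suffices that the body contain the points \<open>3/5 u\<close> and \<open>3/5 u - v\<close>, where \<open>u\<close> runs
  through \<open>U\<close> and \<open>v\<close> through the unit vectors at angle \<open>\<phi>\<close> from \<open>u\<close>. If distinct axes
  satisfy \<open>\<bar>\<langle>u, u'\<rangle>\<bar> \<le> 1/3\<close> and \<open>sin \<phi> = 1/4\<close>, all these points are at mutual distance at most 1
  (lemma \<open>apex_rim_set_diameter\<close>). Every set of diameter at most 1 lies in a maximal one
  (\<open>diametric_completion\<close>), and a maximal one is a body of constant width 1
  (\<open>complete_antipode\<close>, \<open>complete_convex_body\<close>).

  The axes are found by counting among the vectors with all coordinates \<open>\<plusminus>1/\<surd>n\<close>. Up to lower order terms
  a cap \<open>{u. \<langle>\<xi>, u\<rangle> \<ge> 1/4}\<close> contains at most a fraction \<open>exp (-n/32)\<close> of them, and at most a fraction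
  \<open>2 exp (-n/18)\<close> of them has \<open>\<bar>\<langle>u, u'\<rangle>\<bar> > 1/3\<close> with a given \<open>u'\<close> (\<open>card_signs_cap\<close>). For
  \<open>M \<approx> exp (0.027 n)\<close> and \<open>N = n\<^sup>2 M\<close>, the union bound over all pairs and over all choices of \<open>M\<close> caps,
  with \<open>\<xi>\<close> rounded to a grid, leaves an \<open>N\<close>-tuple of vectors that are pairwise separated and not
  covered by any \<open>M\<close> caps (\<open>exists_separated_uncovered_tuple\<close>).

  Since \<open>cos \<phi> = \<surd>15/4\<close> is smaller than \<open>cos (\<pi>/14)\<close>, there is room for all lower order
  terms: \<open>exp 0.027 > 1 / cos (\<pi>/14)\<close>, so the error term can be taken to vanish for all large \<open>n\<close>.
  For the remaining \<open>n\<close> it is \<open>1 - cos (\<pi>/14)\<close>, and any body of constant width will do.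
\<close>

section \<open>Inner products and unit vectors\<close>

lemma in_E_space_iff: "x \<in> E_space n \<longleftrightarrow> (\<forall>i\<ge>n. x i = 0)"
  by (simp add: topspace_Euclidean_space)

lemma E_inner_add_left: "E_inner n (\<lambda>i. x i + y i) z = E_inner n x z + E_inner n y z"
  and E_inner_add_right: "E_inner n z (\<lambda>i. x i + y i) = E_inner n z x + E_inner n z y"
  and E_inner_diff_left: "E_inner n (\<lambda>i. x i - y i) z = E_inner n x z - E_inner n y z"
  and E_inner_diff_right: "E_inner n z (\<lambda>i. x i - y i) = E_inner n z x - E_inner n z y"
  and E_inner_scale_left: "E_inner n (\<lambda>i. k * x i) z = k * E_inner n x z"
  and E_inner_scale_right: "E_inner n z (\<lambda>i. k * x i) = k * E_inner n z x"
  by (simp_all add: E_inner_def algebra_simps sum.distrib sum_subtractf sum_distrib_left)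

lemma E_inner_minus_left: "E_inner n (\<lambda>i. - x i) z = - E_inner n x z"
  and E_inner_minus_right: "E_inner n z (\<lambda>i. - x i) = - E_inner n z x"
  by (simp_all add: E_inner_def sum_negf)

lemma E_inner_divide_left: "E_inner n (\<lambda>i. x i / k) z = E_inner n x z / k"
  and E_inner_divide_right: "E_inner n z (\<lambda>i. x i / k) = E_inner n z x / k"
  by (simp_all add: E_inner_def sum_divide_distrib)

lemmas E_inner_linear =
  E_inner_add_left E_inner_add_right E_inner_diff_left E_inner_diff_right
  E_inner_scale_left E_inner_scale_right E_inner_minus_left E_inner_minus_right
  E_inner_divide_left E_inner_divide_right

lemma E_inner_commute: "E_inner n x y = E_inner n y x"
  by (simp add: E_inner_def mult.commute)

lemma E_inner_self_nonneg: "0 \<le> E_inner n x x"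
  by (simp add: E_inner_def sum_nonneg)

lemma E_norm_eq_sqrt: "E_norm n x = sqrt (E_inner n x x)"
  by (simp add: E_norm_def L2_set_def E_inner_def power2_eq_square)

lemma E_norm_nonneg [simp]: "0 \<le> E_norm n x"
  by (simp add: E_norm_eq_sqrt E_inner_self_nonneg)

lemma E_norm_square: "(E_norm n x)\<^sup>2 = E_inner n x x"
  by (simp add: E_norm_eq_sqrt E_inner_self_nonneg)

lemma E_inner_self_eq_0: "x \<in> E_space n \<Longrightarrow> E_inner n x x = 0 \<longleftrightarrow> x = (\<lambda>_. 0)"
proof
  assume x: "x \<in> E_space n" and 0: "E_inner n x x = 0"
  have "x i = 0" for i
    using x 0 by (cases "i < n") (auto simp: E_inner_def sum_nonneg_eq_0_iff in_E_space_iff)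
  then show "x = (\<lambda>_. 0)" by blast
qed (simp add: E_inner_def)

lemma unit_sphere_iff: "x \<in> unit_sphere n \<longleftrightarrow> x \<in> E_space n \<and> E_inner n x x = 1"
  by (simp add: unit_sphere_def E_norm_eq_sqrt)

lemma E_dist_le_1_iff:
  "E_dist n x y \<le> 1 \<longleftrightarrow> E_inner n (\<lambda>i. x i - y i) (\<lambda>i. x i - y i) \<le> 1"
  by (simp add: E_dist_def E_norm_eq_sqrt)

lemma E_inner_Cauchy_Schwarz: "(E_inner n x y)\<^sup>2 \<le> E_inner n x x * E_inner n y y"
proof -
  have "\<bar>E_inner n x y\<bar> \<le> (\<Sum>i<n. \<bar>x i\<bar> * \<bar>y i\<bar>)"
    unfolding E_inner_def by (rule order_trans[OF sum_abs]) (simp add: abs_mult)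
  also have "\<dots> \<le> E_norm n x * E_norm n y"
    unfolding E_norm_def by (rule L2_set_mult_ineq)
  finally have "\<bar>E_inner n x y\<bar>\<^sup>2 \<le> (E_norm n x * E_norm n y)\<^sup>2"
    by (intro power_mono) auto
  then show ?thesis by (simp add: power_mult_distrib E_norm_square)
qed

lemma E_inner_le_1:
  assumes "E_inner n x x \<le> 1" and "E_inner n y y \<le> 1"
  shows "\<bar>E_inner n x y\<bar> \<le> 1"
proof -
  have "(E_inner n x y)\<^sup>2 \<le> 1 * 1"
    using E_inner_Cauchy_Schwarz[of n x y] mult_mono[OF assms] E_inner_self_nonneg[of n y] by simp
  then show ?thesis by (simp add: abs_square_le_1)
qed

text \<open>
  The normalised component of \<open>a\<close> orthogonal to \<open>u\<close>. It is the unit vector orthogonal to \<open>u\<close> that has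
  the largest inner product with \<open>a\<close>; the hypothesis excludes that \<open>a\<close> is a multiple of \<open>u\<close>.
\<close>

lemma unit_orthogonal_component:
  assumes u: "u \<in> unit_sphere n" and a: "a \<in> E_space n"
    and ne: "(E_inner n a u)\<^sup>2 \<noteq> E_inner n a a"
  obtains w where "w \<in> unit_sphere n" "E_inner n w u = 0"
    "E_inner n a w = sqrt (E_inner n a a - (E_inner n a u)\<^sup>2)"
proof -
  define y where "y = E_inner n a u"
  define b where "b = (\<lambda>i. a i - y * u i)"
  define m where "m = E_inner n a a - y\<^sup>2"
  have uu: "E_inner n u u = 1" and uE: "u \<in> E_space n" using u by (auto simp: unit_sphere_iff)
  have bb: "E_inner n b b = m"
    using uu unfolding b_def m_def
    by (simp add: E_inner_linear E_inner_commute[of n u a] flip: y_def)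
      (simp add: algebra_simps power2_eq_square)
  have "m > 0" using bb E_inner_self_nonneg[of n b] ne unfolding m_def y_def by linarith
  have ab: "E_inner n a b = m"
    by (simp add: b_def E_inner_linear m_def power2_eq_square flip: y_def)
  have bu: "E_inner n b u = 0"
    using uu by (simp add: b_def E_inner_linear flip: y_def)
  show thesis
  proof
    show "(\<lambda>i. b i / sqrt m) \<in> unit_sphere n"
      using uE a bb \<open>m > 0\<close> by (simp add: unit_sphere_iff E_inner_linear in_E_space_iff)
        (simp add: b_def)
    show "E_inner n (\<lambda>i. b i / sqrt m) u = 0"
      by (simp add: E_inner_linear bu)
    show "E_inner n a (\<lambda>i. b i / sqrt m) = sqrt (E_inner n a a - (E_inner n a u)\<^sup>2)"
      using \<open>m > 0\<close> ab by (simp add: E_inner_linear m_def y_def real_div_sqrt)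
  qed
qed

section \<open>Diametrically complete sets\<close>

definition diameter_le_1 :: "nat \<Rightarrow> (nat \<Rightarrow> real) set \<Rightarrow> bool" where
  "diameter_le_1 n S \<longleftrightarrow> S \<subseteq> E_space n \<and> (\<forall>x\<in>S. \<forall>y\<in>S. E_dist n x y \<le> 1)"

text \<open>
  Maximality among the sets of diameter at most 1, in the form in which it is used: such a set is the
  intersection of the unit balls around its own points.
\<close>

definition diametrically_complete :: "nat \<Rightarrow> (nat \<Rightarrow> real) set \<Rightarrow> bool" where
  "diametrically_complete n K \<longleftrightarrow>
     (\<forall>x. x \<in> K \<longleftrightarrow> x \<in> E_space n \<and> (\<forall>y\<in>K. E_dist n x y \<le> 1))"

lemma diametric_completion:
  assumes "diameter_le_1 n S"
  obtains K where "S \<subseteq> K" "diametrically_complete n K"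
proof -
  interpret Metric_space "E_space n" "E_dist n" by (rule E_metric)
  define \<A> where "\<A> = {X. S \<subseteq> X \<and> diameter_le_1 n X}"
  have "\<exists>M\<in>\<A>. \<forall>X\<in>\<A>. M \<subseteq> X \<longrightarrow> X = M"
  proof (rule subset_Zorn_nonempty)
    show "\<A> \<noteq> {}" using assms by (auto simp: \<A>_def)
    fix \<C> assume "\<C> \<noteq> {}" and ch: "subset.chain \<A> \<C>"
    have sub: "\<C> \<subseteq> \<A>" using ch by (auto simp: subset.chain_def)
    have "E_dist n x y \<le> 1" if "x \<in> X" "X \<in> \<C>" "y \<in> Y" "Y \<in> \<C>" for x y X Y
    proof -
      have "X \<subseteq> Y \<or> Y \<subseteq> X" using ch that by (auto simp: subset_chain_def)
      moreover have "diameter_le_1 n X" "diameter_le_1 n Y" using that sub by (auto simp: \<A>_def)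
      ultimately show ?thesis using that unfolding diameter_le_1_def by blast
    qed
    moreover have "S \<subseteq> \<Union>\<C>" "\<Union>\<C> \<subseteq> E_space n"
      using \<open>\<C> \<noteq> {}\<close> sub unfolding \<A>_def diameter_le_1_def by blast+
    ultimately show "\<Union>\<C> \<in> \<A>" unfolding \<A>_def diameter_le_1_def by blast
  qed
  then obtain K where K: "S \<subseteq> K" "diameter_le_1 n K"
    and max: "\<And>X. S \<subseteq> X \<Longrightarrow> diameter_le_1 n X \<Longrightarrow> K \<subseteq> X \<Longrightarrow> X = K"
    by (auto simp: \<A>_def)
  have "x \<in> K" if x: "x \<in> E_space n" "\<forall>y\<in>K. E_dist n x y \<le> 1" for x
  proof -
    have "E_dist n y x \<le> 1" if "y \<in> K" for y
      using that x(2) by (subst commute) blast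
    moreover have "E_dist n x x \<le> 1" using x(1) by simp
    ultimately have "diameter_le_1 n (insert x K)"
      using x K(2) unfolding diameter_le_1_def by blast
    with max[of "insert x K"] K show ?thesis by auto
  qed
  with K(2) have "diametrically_complete n K"
    unfolding diametrically_complete_def diameter_le_1_def by blast
  with K(1) show thesis by (rule that)
qed

lemma complete_in_E_space: "diametrically_complete n K \<Longrightarrow> x \<in> K \<Longrightarrow> x \<in> E_space n"
  unfolding diametrically_complete_def by blast

lemma complete_dist: "diametrically_complete n K \<Longrightarrow> x \<in> K \<Longrightarrow> y \<in> K \<Longrightarrow> E_dist n x y \<le> 1"
  unfolding diametrically_complete_def by blast

text \<open>
  Balls are uniformly convex: for \<open>z = (1 - l) x + l y\<close> and any \<open>k\<close>, the square of the distance from \<open>z\<close>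
  to \<open>k\<close> is the mean of the squares for \<open>x\<close> and \<open>y\<close>, with weights \<open>1 - l\<close> and \<open>l\<close>, less \<open>l (1 - l) |x - y|\<^sup>2\<close>.
  If \<open>x\<close> and \<open>y\<close> are at distance at most 1 from \<open>k\<close>, then \<open>z\<close> is closer by a definite amount, so a ball
  around \<open>z\<close> stays in every complete set that contains \<open>x\<close> and \<open>y\<close>. Convexity, nonempty interior and
  constant width all come from this.
\<close>

lemma complete_contains_ball:
  assumes K: "diametrically_complete n K" and xy: "x \<in> K" "y \<in> K"
    and l: "0 \<le> l" "l \<le> 1"
    and h: "h \<in> E_space n" "E_norm n h \<le> l * (1 - l) * (E_dist n x y)\<^sup>2 / 2"
  shows "(\<lambda>i. (1 - l) * x i + l * y i + h i) \<in> K"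
proof -
  define z where "z = (\<lambda>i. (1 - l) * x i + l * y i)"
  define q where "q = l * (1 - l) * (E_dist n x y)\<^sup>2"
  have q0: "0 \<le> q" unfolding q_def using l by (intro mult_nonneg_nonneg) auto
  have "(\<lambda>i. z i + h i) \<in> E_space n"
    using h(1) complete_in_E_space[OF K xy(1)] complete_in_E_space[OF K xy(2)]
    by (simp add: in_E_space_iff z_def)
  moreover have "E_dist n (\<lambda>i. z i + h i) k \<le> 1" if "k \<in> K" for k
  proof -
    define a where "a = (\<lambda>i. x i - k i)"
    define b where "b = (\<lambda>i. y i - k i)"
    define e where "e = (\<lambda>i. z i - k i)"
    have a1: "E_inner n a a \<le> 1" and b1: "E_inner n b b \<le> 1"
      using complete_dist[OF K _ that] xy by (auto simp: E_dist_le_1_iff a_def b_def)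
    have e: "e = (\<lambda>i. (1 - l) * a i + l * b i)"
      by (auto simp: e_def z_def a_def b_def algebra_simps)
    have d: "(E_dist n x y)\<^sup>2 = E_inner n (\<lambda>i. a i - b i) (\<lambda>i. a i - b i)"
      by (simp add: E_dist_def E_norm_square a_def b_def)
    have "E_inner n e e = (1 - l) * E_inner n a a + l * E_inner n b b - q"
      unfolding q_def d e
      by (simp add: E_inner_linear E_inner_commute[of n b a]) (simp add: algebra_simps)
    also have "\<dots> \<le> (1 - l) * 1 + l * 1 - q"
      using a1 b1 l by (intro diff_right_mono add_mono mult_left_mono) auto
    also have "\<dots> = 1 - q" by simp
    finally have ee: "(E_norm n e)\<^sup>2 \<le> 1 - q" by (simp add: E_norm_square)
    then have q1: "q \<le> 1" using zero_le_power2[of "E_norm n e"] by linarith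
    have "(E_norm n e)\<^sup>2 \<le> (1 - q / 2)\<^sup>2"
    proof -
      have "(1 - q / 2)\<^sup>2 = 1 - q + (q / 2)\<^sup>2" by (simp add: power2_diff)
      with ee zero_le_power2[of "q / 2"] show ?thesis by linarith
    qed
    then have "E_norm n e \<le> 1 - q / 2" using q1 by (rule_tac power2_le_imp_le) auto
    moreover have "E_norm n (\<lambda>i. e i + h i) \<le> E_norm n e + E_norm n h"
      unfolding E_norm_def by (rule L2_set_triangle_ineq)
    moreover have "(\<lambda>i. z i + h i - k i) = (\<lambda>i. e i + h i)" by (auto simp: e_def)
    ultimately show ?thesis using h(2) by (simp add: E_dist_def q_def)
  qed
  ultimately have "(\<lambda>i. z i + h i) \<in> K" using K unfolding diametrically_complete_def by blast
  then show ?thesis by (simp add: z_def)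
qed

lemma complete_convex:
  assumes "diametrically_complete n K"
  shows "E_convex K"
  unfolding E_convex_def
proof (intro ballI allI impI)
  fix x y t assume "x \<in> K" "y \<in> K" and t: "0 \<le> t \<and> (t::real) \<le> 1"
  moreover have "E_norm n (\<lambda>_. 0) = 0" by (simp add: E_norm_eq_sqrt E_inner_def)
  ultimately show "(\<lambda>i. (1 - t) * x i + t * y i) \<in> K"
    using complete_contains_ball[OF assms, of x y t "\<lambda>_. 0"] by (simp add: in_E_space_iff)
qed

lemma complete_compact:
  assumes K: "diametrically_complete n K" and ne: "K \<noteq> {}"
  shows "compactin (Euclidean_space n) K"
proof -
  interpret Metric_space "E_space n" "E_dist n" by (rule E_metric)
  obtain a where a: "a \<in> K" using ne by blast
  have sub: "K \<subseteq> E_space n" using complete_in_E_space[OF K] by blast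
  have "K = (\<Inter>k\<in>K. mcball k 1)"
  proof (intro equalityI subsetI INT_I)
    show "x \<in> mcball k 1" if "x \<in> K" "k \<in> K" for x k
      using that sub complete_dist[OF K, of k x] by (auto simp: mcball_def)
    show "x \<in> K" if "x \<in> (\<Inter>k\<in>K. mcball k 1)" for x
    proof -
      have "E_dist n x k \<le> 1" if "k \<in> K" for k
        using \<open>x \<in> (\<Inter>k\<in>K. mcball k 1)\<close> that by (subst commute) (simp add: mcball_def)
      moreover have "x \<in> E_space n" using that a by (auto simp: mcball_def)
      ultimately show ?thesis using K unfolding diametrically_complete_def by blast
    qed
  qed
  moreover have "closedin mtopology (\<Inter>k\<in>K. mcball k 1)"
    using ne by (intro closedin_INT) auto
  ultimately have "closedin (Euclidean_space n) K" by (simp add: E_mtopology)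
  then have cl: "closedin (powertop_real UNIV) K"
    unfolding Euclidean_space_def
    by (metis Euclidean_space_def closedin_Euclidean_space closedin_closed_subtopology
        topspace_Euclidean_space)
  have "compactin (powertop_real UNIV) (PiE UNIV (\<lambda>i. {a i - 1..a i + 1}))"
    by (simp add: compactin_PiE)
  moreover have "K \<subseteq> PiE UNIV (\<lambda>i. {a i - 1..a i + 1})"
  proof
    fix x assume x: "x \<in> K"
    have "\<bar>x i - a i\<bar> \<le> 1" for i
    proof (cases "i < n")
      case True
      have "(x i - a i)\<^sup>2 \<le> E_inner n (\<lambda>i. x i - a i) (\<lambda>i. x i - a i)"
        unfolding E_inner_def power2_eq_square using True
        by (intro member_le_sum[of i "{..<n}" "\<lambda>i. (x i - a i) * (x i - a i)"]) auto
      then have "(x i - a i)\<^sup>2 \<le> 1"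
        using complete_dist[OF K x a] unfolding E_dist_le_1_iff by linarith
      then show ?thesis by (simp add: abs_square_le_1)
    next
      case False
      have "x \<in> E_space n" "a \<in> E_space n" using x a sub by auto
      with False show ?thesis by (simp add: in_E_space_iff)
    qed
    then have "a i - 1 \<le> x i \<and> x i \<le> a i + 1" for i by (smt (verit, ccfv_SIG))
    then show "x \<in> PiE UNIV (\<lambda>i. {a i - 1..a i + 1})" by auto
  qed
  ultimately have "compactin (powertop_real UNIV) K" using cl by (rule closed_compactin)
  then show ?thesis
    using sub by (simp add: Euclidean_space_def compactin_subtopology)
qed

lemma interior_of_E_space:
  "z \<in> Euclidean_space n interior_of K \<longleftrightarrow>
     z \<in> E_space n \<and> (\<exists>e>0. \<forall>x\<in>E_space n. E_dist n z x < e \<longrightarrow> x \<in> K)"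
proof -
  interpret Metric_space "E_space n" "E_dist n" by (rule E_metric)
  show ?thesis
  proof
    assume "z \<in> Euclidean_space n interior_of K"
    then obtain T where T: "openin mtopology T" "z \<in> T" "T \<subseteq> K"
      by (auto simp: interior_of_def E_mtopology)
    then obtain e where "e > 0" "mball z e \<subseteq> T" and z: "z \<in> E_space n"
      unfolding openin_mtopology by blast
    with T show "z \<in> E_space n \<and> (\<exists>e>0. \<forall>x\<in>E_space n. E_dist n z x < e \<longrightarrow> x \<in> K)"
      by (auto simp: mball_def subset_iff)
  next
    assume "z \<in> E_space n \<and> (\<exists>e>0. \<forall>x\<in>E_space n. E_dist n z x < e \<longrightarrow> x \<in> K)"
    then obtain e where e: "z \<in> E_space n" "e > 0" "\<forall>x\<in>E_space n. E_dist n z x < e \<longrightarrow> x \<in> K"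
      by blast
    then have "mball z e \<subseteq> K" "z \<in> mball z e" by (auto simp: mball_def)
    then show "z \<in> Euclidean_space n interior_of K"
      unfolding interior_of_def by (metis (mono_tags, lifting) E_mtopology mem_Collect_eq openin_mball)
  qed
qed

lemma complete_interior:
  assumes K: "diametrically_complete n K" and xy: "x \<in> K" "y \<in> K" "x \<noteq> y"
  shows "Euclidean_space n interior_of K \<noteq> {}"
proof -
  interpret Metric_space "E_space n" "E_dist n" by (rule E_metric)
  define z where "z = (\<lambda>i. (1 - 1/2) * x i + 1/2 * y i)"
  define e where "e = (1/2) * (1 - 1/2) * (E_dist n x y)\<^sup>2 / 2"
  have E: "x \<in> E_space n" "y \<in> E_space n" using complete_in_E_space[OF K] xy by auto
  then have "e > 0" using xy(3) by (simp add: e_def)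
  moreover have zE: "z \<in> E_space n" using E by (auto simp: z_def in_E_space_iff)
  moreover have "v \<in> K" if v: "v \<in> E_space n" "E_dist n z v < e" for v
  proof -
    have "E_norm n (\<lambda>i. v i - z i) \<le> e"
      using v commute[of z v] by (simp add: E_dist_def)
    moreover have "(\<lambda>i. v i - z i) \<in> E_space n" using v zE by (auto simp: in_E_space_iff)
    ultimately have "(\<lambda>i. (1 - 1/2) * x i + 1/2 * y i + (v i - z i)) \<in> K"
      unfolding e_def by (intro complete_contains_ball[OF K xy(1,2)]) auto
    then show ?thesis by (simp add: z_def)
  qed
  ultimately have "z \<in> Euclidean_space n interior_of K" by (auto simp: interior_of_E_space)
  then show ?thesis by blast
qed

text \<open>
  If \<open>x - u\<close> were missing, some \<open>y\<close> in the set would be further than 1 from it, which says that \<open>y\<close> lies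
  only slightly below the supporting hyperplane at \<open>x\<close>: the depth is less than \<open>|x - y|\<^sup>2 / 2\<close>. The ball that
  \<open>complete_contains_ball\<close> puts around a point of the segment close to \<open>x\<close> then sticks out beyond
  the hyperplane.
\<close>

lemma complete_antipode:
  assumes K: "diametrically_complete n K" and x: "x \<in> K" and u: "u \<in> unit_sphere n"
    and supp: "\<And>y. y \<in> K \<Longrightarrow> E_inner n u y \<le> E_inner n u x"
  shows "(\<lambda>i. x i - u i) \<in> K"
proof (rule ccontr)
  have uu: "E_inner n u u = 1" and uE: "u \<in> E_space n" using u by (auto simp: unit_sphere_iff)
  assume "(\<lambda>i. x i - u i) \<notin> K"
  moreover have "(\<lambda>i. x i - u i) \<in> E_space n"
    using uE complete_in_E_space[OF K x] by (auto simp: in_E_space_iff)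
  ultimately obtain y where y: "y \<in> K" and far: "\<not> E_dist n (\<lambda>i. x i - u i) y \<le> 1"
    using K unfolding diametrically_complete_def by blast
  define D where "D = (E_dist n x y)\<^sup>2"
  define s where "s = E_inner n u (\<lambda>i. y i - x i)"
  have D: "D = E_inner n (\<lambda>i. x i - y i) (\<lambda>i. x i - y i)"
    by (simp add: D_def E_dist_def E_norm_square)
  have "E_inner n (\<lambda>i. x i - u i - y i) (\<lambda>i. x i - u i - y i) = D + 2 * s + 1"
    by (simp add: D s_def E_inner_linear uu E_inner_commute)
  then have sD: "s > - D / 2" using far by (simp add: E_dist_le_1_iff)
  have s0: "s \<le> 0" using supp[OF y] by (simp add: s_def E_inner_linear)
  have D1: "D \<le> 1" using complete_dist[OF K x y] unfolding D E_dist_le_1_iff .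
  \<comment> \<open>The ball around \<open>(1 - l) x + l y\<close> reaches height \<open>l (s + (1 - l) D / 2)\<close>, which is positive for this \<open>l\<close>.\<close>
  define l where "l = s + D / 2"
  have l: "0 < l" "l \<le> 1" using sD s0 D1 by (auto simp: l_def)
  define q where "q = l * (1 - l) * D / 2"
  define h where "h = (\<lambda>i. q * u i)"
  have "0 \<le> D" using s0 sD by linarith
  then have "0 \<le> q" unfolding q_def using l by (intro divide_nonneg_nonneg mult_nonneg_nonneg) auto
  then have "E_norm n h \<le> q"
    by (simp add: E_norm_eq_sqrt h_def E_inner_linear uu)
  then have "E_norm n h \<le> l * (1 - l) * (E_dist n x y)\<^sup>2 / 2" by (simp add: q_def D_def)
  moreover have "h \<in> E_space n" using uE by (auto simp: h_def in_E_space_iff)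
  ultimately have "(\<lambda>i. (1 - l) * x i + l * y i + h i) \<in> K"
    using l by (intro complete_contains_ball[OF K x y]) auto
  from supp[OF this] have "l * s + l * (1 - l) * D / 2 \<le> 0"
    by (simp add: s_def h_def q_def E_inner_linear uu algebra_simps)
  then have "l * (s + (1 - l) * D / 2) \<le> 0" by (simp add: algebra_simps)
  then have "s + (1 - l) * D / 2 \<le> 0" using l by (simp add: mult_le_0_iff)
  then have "l * 1 \<le> l * (D / 2)" by (simp add: l_def field_simps)
  then show False using l D1 by (simp add: mult_le_cancel_left)
qed

section \<open>Constant width of complete sets\<close>

text \<open>
  Supporting and parallel hyperplanes each come with a normal of their own. Because the normal of a hyperplane is
  unique up to a factor, two parallel supporting hyperplanes can be described with one common normal.
\<close>

lemma hyperplane_normal_unique: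
  assumes u: "u \<in> E_space n" "u \<noteq> (\<lambda>_. 0)" and v: "v \<in> E_space n"
    and eq: "hyperplane n u c = hyperplane n v d" and h: "h \<in> hyperplane n u c"
  obtains k where "v = (\<lambda>i. k * u i)" "d = k * c"
proof -
  define uu where "uu = E_inner n u u"
  have uu: "uu \<noteq> 0" using E_inner_self_eq_0[OF u(1)] u(2) by (simp add: uu_def)
  define k where "k = E_inner n u v / uu"
  define z where "z = (\<lambda>i. v i - k * u i)"
  have zu: "E_inner n u z = 0"
    using uu by (simp add: z_def E_inner_linear k_def flip: uu_def)
  have zE: "z \<in> E_space n" using u v by (simp add: z_def in_E_space_iff)
  have hE: "h \<in> E_space n" and hc: "E_inner n u h = c" using h by (auto simp: hyperplane_def)
  have hd: "E_inner n v h = d" using h eq by (auto simp: hyperplane_def)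
  have "(\<lambda>i. h i + z i) \<in> hyperplane n u c"
    using hE zE hc zu by (simp add: hyperplane_def E_inner_linear in_E_space_iff)
  then have "E_inner n v z = 0"
    using hd unfolding eq by (simp add: hyperplane_def E_inner_linear)
  then have "E_inner n z z = 0"
    using zu by (subst (1) z_def) (simp add: E_inner_linear)
  then have "z = (\<lambda>_. 0)" using E_inner_self_eq_0[OF zE] by blast
  then have vk: "v = (\<lambda>i. k * u i)" by (auto simp: z_def fun_eq_iff)
  moreover have "d = k * c" using hd hc by (simp add: vk E_inner_linear)
  ultimately show thesis by (rule that)
qed

lemma supporting_hyperplane_sides:
  assumes u: "u \<in> E_space n" "u \<noteq> (\<lambda>_. 0)"
    and supp: "supporting_hyperplane n K (hyperplane n u c)"
  obtains x where "x \<in> K" "E_inner n u x = c"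
    "(\<forall>y\<in>K. E_inner n u y \<le> c) \<or> (\<forall>y\<in>K. c \<le> E_inner n u y)"
proof -
  obtain v d where v: "v \<in> E_space n" "v \<noteq> (\<lambda>_. 0)" and eq: "hyperplane n u c = hyperplane n v d"
    and ne: "hyperplane n u c \<inter> K \<noteq> {}" and le: "\<forall>y\<in>K. E_inner n v y \<le> d"
    using supp unfolding supporting_hyperplane_def by auto
  obtain x where x: "x \<in> hyperplane n u c" "x \<in> K" using ne by blast
  obtain k where k: "v = (\<lambda>i. k * u i)" "d = k * c"
    using hyperplane_normal_unique[OF u v(1) eq x(1)] .
  have k0: "k \<noteq> 0" using v(2) k(1) by auto
  have le': "k * E_inner n u y \<le> k * c" if "y \<in> K" for y
    using le that by (simp add: k E_inner_linear)
  have "(\<forall>y\<in>K. E_inner n u y \<le> c) \<or> (\<forall>y\<in>K. c \<le> E_inner n u y)"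
  proof (cases "k > 0")
    case True
    then show ?thesis using le' by simp
  next
    case False
    then show ?thesis using le' k0 by (simp add: mult_le_cancel_left)
  qed
  then show thesis using x by (intro that[of x]) (auto simp: hyperplane_def)
qed

lemma E_setdist_parallel_hyperplanes:
  assumes u: "u \<in> unit_sphere n"
  shows "E_setdist n (hyperplane n u a) (hyperplane n u b) = \<bar>a - b\<bar>"
proof -
  have uE: "u \<in> E_space n" and uu: "E_inner n u u = 1" using u by (auto simp: unit_sphere_iff)
  let ?S = "{E_dist n x y |x y. x \<in> hyperplane n u a \<and> y \<in> hyperplane n u b}"
  have "\<bar>a - b\<bar> \<in> ?S"
  proof -
    have "(\<lambda>i. a * u i) \<in> hyperplane n u a" "(\<lambda>i. b * u i) \<in> hyperplane n u b"
      using uE by (auto simp: hyperplane_def in_E_space_iff E_inner_linear uu)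
    moreover have "E_dist n (\<lambda>i. a * u i) (\<lambda>i. b * u i) = \<bar>a - b\<bar>"
    proof -
      have "(\<lambda>i. a * u i - b * u i) = (\<lambda>i. (a - b) * u i)" by (auto simp: algebra_simps)
      then have "E_dist n (\<lambda>i. a * u i) (\<lambda>i. b * u i) = E_norm n (\<lambda>i. (a - b) * u i)"
        by (simp only: E_dist_def)
      also have "\<dots> = sqrt ((a - b) * (a - b))"
        by (simp add: E_norm_eq_sqrt E_inner_linear uu del: real_sqrt_mult_self)
      finally show ?thesis by simp
    qed
    ultimately show ?thesis by (smt (verit, best) mem_Collect_eq)
  qed
  moreover have "\<bar>a - b\<bar> \<le> s" if "s \<in> ?S" for s
  proof -
    obtain x y where s: "s = E_dist n x y" "E_inner n u x = a" "E_inner n u y = b"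
      using \<open>s \<in> ?S\<close> by (auto simp: hyperplane_def)
    have "(a - b)\<^sup>2 \<le> (E_dist n x y)\<^sup>2"
      using E_inner_Cauchy_Schwarz[of n u "\<lambda>i. x i - y i"] s uu
      by (simp add: E_inner_diff_right E_dist_def E_norm_square del: E_norm_nonneg)
    then show ?thesis using s by (simp add: abs_le_square_iff[symmetric] E_dist_def)
  qed
  ultimately show ?thesis unfolding E_setdist_def by (intro cInf_eq_minimum)
qed

text \<open>
  The upper bound is the diameter, the lower bound is \<open>complete_antipode\<close>.
\<close>

lemma complete_width:
  assumes K: "diametrically_complete n K" and u: "u \<in> unit_sphere n"
    and x: "x \<in> K" "\<And>y. y \<in> K \<Longrightarrow> E_inner n u y \<le> E_inner n u x"
    and x': "x' \<in> K" "\<And>y. y \<in> K \<Longrightarrow> E_inner n u x' \<le> E_inner n u y"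
  shows "E_inner n u x - E_inner n u x' = 1"
proof -
  have uu: "E_inner n u u = 1" using u by (simp add: unit_sphere_iff)
  have "E_inner n u (\<lambda>i. x i - x' i) \<le> 1"
    using E_inner_le_1[of n u "\<lambda>i. x i - x' i"] uu complete_dist[OF K x(1) x'(1)]
    by (simp add: E_dist_le_1_iff)
  moreover have "E_inner n u x' \<le> E_inner n u (\<lambda>i. x i - u i)"
    using complete_antipode[OF K x(1) u x(2)] by (rule x'(2))
  ultimately show ?thesis using uu by (simp add: E_inner_linear)
qed

lemma complete_constant_width:
  assumes K: "diametrically_complete n K"
  shows "constant_width_of n K 1"
  unfolding constant_width_of_def
proof (intro allI impI, elim conjE)
  fix H H'
  assume sH: "supporting_hyperplane n K H" and sH': "supporting_hyperplane n K H'"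
    and par: "parallel_hyperplanes n H H'" and ne: "H \<noteq> H'"
  obtain v c c' where v: "v \<in> E_space n" "v \<noteq> (\<lambda>_. 0)"
    and H: "H = hyperplane n v c" and H': "H' = hyperplane n v c'"
    using par unfolding parallel_hyperplanes_def by blast
  define s where "s = E_norm n v"
  have s: "s > 0" using E_inner_self_eq_0[OF v(1)] v(2) E_inner_self_nonneg[of n v]
    by (simp add: s_def E_norm_eq_sqrt order_less_le)
  define u where "u = (\<lambda>i. v i / s)"
  have u: "u \<in> unit_sphere n"
    using v s by (simp add: u_def unit_sphere_iff in_E_space_iff E_inner_linear flip: E_norm_square)
      (simp add: s_def power2_eq_square)
  then have uE: "u \<in> E_space n" "u \<noteq> (\<lambda>_. 0)"
    by (auto simp: unit_sphere_iff E_inner_def)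
  have hyp: "hyperplane n v a = hyperplane n u (a / s)" for a
    using s by (auto simp: hyperplane_def u_def E_inner_linear)
  define a where "a = c / s"
  define a' where "a' = c' / s"
  have Hu: "H = hyperplane n u a" and Hu': "H' = hyperplane n u a'"
    using H H' hyp by (auto simp: a_def a'_def)
  have aa: "a \<noteq> a'" using ne Hu Hu' by auto
  obtain x where x: "x \<in> K" "E_inner n u x = a"
    "(\<forall>y\<in>K. E_inner n u y \<le> a) \<or> (\<forall>y\<in>K. a \<le> E_inner n u y)"
    using supporting_hyperplane_sides[OF uE] sH Hu by metis
  obtain x' where x': "x' \<in> K" "E_inner n u x' = a'"
    "(\<forall>y\<in>K. E_inner n u y \<le> a') \<or> (\<forall>y\<in>K. a' \<le> E_inner n u y)"
    using supporting_hyperplane_sides[OF uE] sH' Hu' by metis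
  have "\<bar>a - a'\<bar> = 1"
  proof (cases "a' < a")
    case True
    then have "\<forall>y\<in>K. E_inner n u y \<le> a" "\<forall>y\<in>K. a' \<le> E_inner n u y"
      using x x' by fastforce+
    then show ?thesis using complete_width[OF K u x(1) _ x'(1)] x(2) x'(2) by simp
  next
    case False
    then have "a < a'" using aa by simp
    then have "\<forall>y\<in>K. E_inner n u y \<le> a'" "\<forall>y\<in>K. a \<le> E_inner n u y"
      using x x' by fastforce+
    then show ?thesis using complete_width[OF K u x'(1) _ x(1)] x(2) x'(2) by simp
  qed
  then show "E_setdist n H H' = 1"
    by (simp add: Hu Hu' E_setdist_parallel_hyperplanes[OF u])
qed

section \<open>Illumination of complete sets\<close>

text \<open>
  The set lies in the unit ball around \<open>x - v\<close>, and \<open>x\<close> is on the boundary of that ball, so \<open>v\<close> is an outer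
  normal of the set at \<open>x\<close>.
\<close>

lemma interior_below_far_point:
  assumes K: "diametrically_complete n K" and x: "x \<in> K" and v: "v \<in> unit_sphere n"
    and p: "(\<lambda>i. x i - v i) \<in> K" and z: "z \<in> Euclidean_space n interior_of K"
  shows "E_inner n z v < E_inner n x v"
proof -
  have vE: "v \<in> E_space n" and vv: "E_inner n v v = 1" using v by (auto simp: unit_sphere_iff)
  have below: "E_inner n y v \<le> E_inner n x v" if "y \<in> K" for y
  proof -
    define d where "d = (\<lambda>i. y i - x i)"
    have "(\<lambda>i. y i - (x i - v i)) = (\<lambda>i. d i + v i)" by (auto simp: d_def)
    then have "E_inner n (\<lambda>i. d i + v i) (\<lambda>i. d i + v i) \<le> 1"
      using complete_dist[OF K that p] by (simp add: E_dist_le_1_iff)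
    then have "E_inner n d d + 2 * E_inner n d v \<le> 0"
      by (simp add: E_inner_add_left E_inner_add_right vv E_inner_commute[of n v d])
    then have "E_inner n d v \<le> 0" using E_inner_self_nonneg[of n d] by linarith
    then show ?thesis by (simp add: d_def E_inner_linear)
  qed
  obtain e where zE: "z \<in> E_space n" and e: "e > 0" "\<And>y. y \<in> E_space n \<Longrightarrow> E_dist n z y < e \<Longrightarrow> y \<in> K"
    using z unfolding interior_of_E_space by blast
  have "E_dist n z (\<lambda>i. z i + (e / 2) * v i) = E_norm n (\<lambda>i. (- (e / 2)) * v i)"
    by (simp add: E_dist_def)
  also have "\<dots> = sqrt ((e / 2)\<^sup>2)"
    unfolding E_norm_eq_sqrt E_inner_scale_left E_inner_scale_right vv
    by (simp add: power2_eq_square)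
  also have "\<dots> = e / 2" using e(1) by simp
  finally have "(\<lambda>i. z i + (e / 2) * v i) \<in> K"
    using zE vE e(1) by (intro e(2)) (auto simp: in_E_space_iff)
  from below[OF this] have "E_inner n z v + (e / 2) * E_inner n v v \<le> E_inner n x v"
    by (simp only: E_inner_add_left E_inner_scale_left)
  then show ?thesis using e(1) vv by simp
qed

lemma far_point_in_frontier:
  assumes K: "diametrically_complete n K" and x: "x \<in> K" and v: "v \<in> unit_sphere n"
    and p: "(\<lambda>i. x i - v i) \<in> K"
  shows "x \<in> Euclidean_space n frontier_of K"
proof -
  have "K \<subseteq> E_space n" using complete_in_E_space[OF K] by blast
  then have "x \<in> Euclidean_space n closure_of K" using x closure_of_subset by blast
  moreover have "x \<notin> Euclidean_space n interior_of K"
    using interior_below_far_point[OF assms] by blast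
  ultimately show ?thesis by (simp add: frontier_of_def)
qed

lemma illuminates_far_point:
  assumes K: "diametrically_complete n K" and x: "x \<in> K" and v: "v \<in> unit_sphere n"
    and p: "(\<lambda>i. x i - v i) \<in> K" and ill: "illuminates n K \<xi> x"
  shows "E_inner n \<xi> v < 0"
proof -
  obtain t where t: "t \<ge> 0" "(\<lambda>i. x i + t * \<xi> i) \<in> Euclidean_space n interior_of K"
    using ill by (auto simp: illuminates_def)
  have "t * E_inner n \<xi> v < 0"
    using interior_below_far_point[OF K x v p t(2)] by (simp add: E_inner_linear)
  then show ?thesis using t(1) by (simp add: mult_less_0_iff)
qed

lemma exists_unit_vector:
  assumes "n \<ge> 1"
  obtains e where "e \<in> unit_sphere n"
proof
  show "(\<lambda>i::nat. if i = 0 then 1 else 0 :: real) \<in> unit_sphere n"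
    using assms by (auto simp: unit_sphere_iff in_E_space_iff E_inner_def if_distrib if_distribR
        sum.delta cong: if_cong)
qed

text \<open>
  The infimum over an empty set of cardinalities would be 0, so a lower bound on the illumination number
  needs a finite illuminating set to exist. Every point of \<open>K\<close> is illuminated by the direction to a fixed
  interior point, the points illuminated by one direction form an open set, and \<open>K\<close> is compact.
\<close>

lemma finite_illuminating_set:
  assumes K: "convex_body n K" and n: "n \<ge> 1"
  obtains \<Xi> where "finite \<Xi>" "\<Xi> \<subseteq> unit_sphere n"
    "\<forall>x \<in> Euclidean_space n frontier_of K. \<exists>\<xi>\<in>\<Xi>. illuminates n K \<xi> x"
proof -
  interpret Metric_space "E_space n" "E_dist n" by (rule E_metric)
  let ?I = "Euclidean_space n interior_of K"
  define L where "L \<xi> = {x \<in> E_space n. illuminates n K \<xi> x}" for \<xi>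
  have comp: "compactin mtopology K" using K by (simp add: convex_body_def E_mtopology)
  then have KE: "K \<subseteq> E_space n" using compactin_subset_topspace by fastforce
  obtain z where z: "z \<in> ?I" using K by (auto simp: convex_body_def)
  have op: "openin mtopology (L \<xi>)" if \<xi>: "\<xi> \<in> E_space n" for \<xi>
    unfolding openin_mtopology
  proof (intro conjI allI impI)
    fix x assume "x \<in> L \<xi>"
    then obtain t where t: "t \<ge> 0" "(\<lambda>i. x i + t * \<xi> i) \<in> ?I" and xE: "x \<in> E_space n"
      by (auto simp: L_def illuminates_def)
    have "openin mtopology ?I" by (simp add: E_mtopology)
    then obtain r where r: "r > 0" "mball (\<lambda>i. x i + t * \<xi> i) r \<subseteq> ?I"
      using t(2) unfolding openin_mtopology by blast
    have "mball x r \<subseteq> L \<xi>"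
    proof
      fix y assume y: "y \<in> mball x r"
      have "(\<lambda>i. x i + t * \<xi> i - (y i + t * \<xi> i)) = (\<lambda>i. x i - y i)" by auto
      then have "E_dist n (\<lambda>i. x i + t * \<xi> i) (\<lambda>i. y i + t * \<xi> i) = E_dist n x y"
        by (simp only: E_dist_def)
      then have "(\<lambda>i. y i + t * \<xi> i) \<in> mball (\<lambda>i. x i + t * \<xi> i) r"
        using y xE \<xi> by (simp add: in_mball in_E_space_iff)
      with r(2) t(1) y show "y \<in> L \<xi>" by (auto simp: L_def illuminates_def)
    qed
    with r(1) show "\<exists>r>0. mball x r \<subseteq> L \<xi>" by blast
  qed (auto simp: L_def)
  have cov: "\<exists>\<xi>\<in>unit_sphere n. x \<in> L \<xi>" if x: "x \<in> K" for x
  proof (cases "x = z")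
    case True
    obtain e where "e \<in> unit_sphere n" using exists_unit_vector[OF n] .
    moreover have "x \<in> L e"
      using z x KE True by (auto simp: L_def illuminates_def intro!: exI[of _ 0])
    ultimately show ?thesis by blast
  next
    case False
    have zE: "z \<in> E_space n" and xE: "x \<in> E_space n"
      using z x KE by (auto simp: interior_of_E_space)
    define s where "s = E_dist n x z"
    have s: "s > 0" using False zE xE by (simp add: s_def)
    define \<xi> where "\<xi> = (\<lambda>i. (x i - z i) / (- s))"
    have "E_inner n \<xi> \<xi> = s\<^sup>2 / (s * s)"
      unfolding \<xi>_def E_inner_divide_left E_inner_divide_right s_def
      by (simp add: E_dist_def E_norm_square)
    then have "\<xi> \<in> unit_sphere n"
      using s zE xE by (auto simp: unit_sphere_iff in_E_space_iff \<xi>_def power2_eq_square)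
    moreover have "(\<lambda>i. x i + s * \<xi> i) = z" using s by (auto simp: \<xi>_def)
    then have "x \<in> L \<xi>" using s xE z by (auto simp: L_def illuminates_def intro!: exI[of _ s])
    ultimately show ?thesis by blast
  qed
  have "\<exists>\<F>. finite \<F> \<and> \<F> \<subseteq> L ` unit_sphere n \<and> K \<subseteq> \<Union>\<F>"
  proof -
    have "\<forall>V \<in> L ` unit_sphere n. openin mtopology V"
      using op by (auto simp: unit_sphere_iff)
    moreover have "K \<subseteq> \<Union>(L ` unit_sphere n)" using cov by blast
    ultimately show ?thesis using comp unfolding compactin_def by blast
  qed
  then obtain \<F> where \<F>: "finite \<F>" "\<F> \<subseteq> L ` unit_sphere n" "K \<subseteq> \<Union>\<F>" by blast
  obtain \<Xi> where \<Xi>: "finite \<Xi>" "\<Xi> \<subseteq> unit_sphere n" "\<F> = L ` \<Xi>"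
    using finite_subset_image[OF \<F>(1,2)] by blast
  have "Euclidean_space n closure_of K \<subseteq> K"
    using compactin_imp_closedin[OF Hausdorff_space_mtopology comp]
    by (simp add: E_mtopology closure_of_closedin)
  then have "Euclidean_space n frontier_of K \<subseteq> K" by (auto simp: frontier_of_def)
  then have "\<forall>x \<in> Euclidean_space n frontier_of K. \<exists>\<xi>\<in>\<Xi>. illuminates n K \<xi> x"
    using \<F>(3) \<Xi>(3) unfolding L_def by blast
  with \<Xi>(1,2) show thesis by (rule that)
qed

lemma illumination_number_greater:
  assumes K: "convex_body n K" and n: "n \<ge> 1"
    and few: "\<And>\<Xi>. finite \<Xi> \<Longrightarrow> \<Xi> \<subseteq> unit_sphere n \<Longrightarrow> card \<Xi> \<le> M \<Longrightarrow>
      \<exists>x \<in> Euclidean_space n frontier_of K. \<forall>\<xi>\<in>\<Xi>. \<not> illuminates n K \<xi> x"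
  shows "M < illumination_number n K"
proof -
  let ?S = "{card \<Xi> |\<Xi>. finite \<Xi> \<and> \<Xi> \<subseteq> unit_sphere n \<and>
    (\<forall>x \<in> Euclidean_space n frontier_of K. \<exists>\<xi>\<in>\<Xi>. illuminates n K \<xi> x)}"
  obtain \<Xi> where "finite \<Xi>" "\<Xi> \<subseteq> unit_sphere n"
    "\<forall>x \<in> Euclidean_space n frontier_of K. \<exists>\<xi>\<in>\<Xi>. illuminates n K \<xi> x"
    using finite_illuminating_set[OF K n] by metis
  then have "?S \<noteq> {}" by blast
  then have "Inf ?S \<in> ?S" by (rule Inf_nat_def1)
  then obtain \<Xi> where \<Xi>: "illumination_number n K = card \<Xi>" "finite \<Xi>" "\<Xi> \<subseteq> unit_sphere n"
    "\<forall>x \<in> Euclidean_space n frontier_of K. \<exists>\<xi>\<in>\<Xi>. illuminates n K \<xi> x"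
    unfolding illumination_number_def by auto
  show ?thesis
  proof (rule ccontr)
    assume "\<not> M < illumination_number n K"
    then have "card \<Xi> \<le> M" by (simp add: \<Xi>(1))
    from few[OF \<Xi>(2,3) this] \<Xi>(4) show False by blast
  qed
qed

lemma complete_convex_body:
  assumes "diametrically_complete n K" "x \<in> K" "y \<in> K" "x \<noteq> y"
  shows "convex_body n K" "constant_width n K"
proof -
  have "compactin (Euclidean_space n) K" using complete_compact[OF assms(1)] assms(2) by blast
  then show "convex_body n K"
    using complete_convex[OF assms(1)] complete_interior[OF assms] by (simp add: convex_body_def)
  show "constant_width n K"
    using complete_constant_width[OF assms(1)] unfolding constant_width_def by blast
qed

section \<open>A set of diameter one with many wide normal cones\<close>

text \<open>
  What is required of the set of axes \<open>U\<close>: its members are nearly orthogonal, so that the points built on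
  them have diameter at most 1, and no \<open>M\<close> of the caps in which a direction can reach an axis cover
  it.
\<close>

definition cap_resistant :: "nat \<Rightarrow> nat \<Rightarrow> (nat \<Rightarrow> real) set \<Rightarrow> bool" where
  "cap_resistant n M U \<longleftrightarrow> U \<subseteq> unit_sphere n \<and>
     (\<forall>u\<in>U. \<forall>v\<in>U. u \<noteq> v \<longrightarrow> \<bar>E_inner n u v\<bar> \<le> 1/3) \<and>
     (\<forall>\<Xi>. finite \<Xi> \<and> \<Xi> \<subseteq> unit_sphere n \<and> card \<Xi> \<le> M \<longrightarrow>
        (\<exists>u\<in>U. \<forall>\<xi>\<in>\<Xi>. E_inner n \<xi> u < 1/4))"

text \<open>
  The cosine of the angle \<open>\<phi>\<close> with \<open>sin \<phi> = 1/4\<close>.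
\<close>

definition rim_cos :: real where "rim_cos = sqrt 15 / 4"

lemma rim_cos_bounds: "0.968 \<le> rim_cos" "rim_cos \<le> 0.9683"
proof -
  have "3.872 \<le> sqrt 15" by (rule real_le_rsqrt) (simp add: power2_eq_square)
  moreover have "sqrt 15 \<le> 3.8732" by (rule real_le_lsqrt) (simp_all add: power2_eq_square)
  ultimately show "0.968 \<le> rim_cos" "rim_cos \<le> 0.9683" by (simp_all add: rim_cos_def)
qed

lemma rim_cos_square: "rim_cos\<^sup>2 = 15/16"
  by (simp add: rim_cos_def power_divide)

text \<open>
  The unit vectors at angle \<open>\<phi>\<close> from \<open>u\<close>. They span a cone of normals that the body will have
  at the point \<open>3/5 u\<close>.
\<close>

definition rim :: "nat \<Rightarrow> (nat \<Rightarrow> real) \<Rightarrow> (nat \<Rightarrow> real) set" where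
  "rim n u = {(\<lambda>i. rim_cos * u i + 1/4 * w i) |w. w \<in> unit_sphere n \<and> E_inner n w u = 0}"

lemma rim_unit:
  assumes u: "u \<in> unit_sphere n" and v: "v \<in> rim n u"
  shows "v \<in> unit_sphere n"
proof -
  obtain w where w: "w \<in> unit_sphere n" "E_inner n w u = 0" "v = (\<lambda>i. rim_cos * u i + 1/4 * w i)"
    using v by (auto simp: rim_def)
  then have "E_inner n v v = rim_cos\<^sup>2 + 1/16"
    using u by (simp add: unit_sphere_iff E_inner_linear E_inner_commute[of n u w] power2_eq_square)
  then have "E_inner n v v = 1" by (simp add: rim_cos_square)
  then show ?thesis using u w by (simp add: unit_sphere_iff in_E_space_iff)
qed

text \<open>
  Among the unit vectors at angle \<open>\<phi>\<close> from \<open>u\<close>, the one nearest to \<open>\<xi>\<close> has inner product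
  \<open>y cos \<phi> + sqrt (1 - y\<^sup>2) sin \<phi>\<close> with \<open>\<xi>\<close>, where \<open>y = \<langle>\<xi>, u\<rangle>\<close>. This is negative only if
  \<open>y < - sin \<phi>\<close>. The vector \<open>a\<close> serves only to ensure that the rim is not empty when \<open>\<xi>\<close> is parallel
  to \<open>u\<close>.
\<close>

lemma rim_meets_halfspace:
  assumes u: "u \<in> unit_sphere n" and a: "a \<in> unit_sphere n" "a \<noteq> u" "a \<noteq> (\<lambda>i. - u i)"
    and \<xi>: "\<xi> \<in> unit_sphere n" and neg: "\<And>v. v \<in> rim n u \<Longrightarrow> E_inner n \<xi> v < 0"
  shows "E_inner n \<xi> u \<le> - 1/4"
proof -
  define y where "y = E_inner n \<xi> u"
  have uu: "E_inner n u u = 1" and uE: "u \<in> E_space n" using u by (auto simp: unit_sphere_iff)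
  have \<xi>\<xi>: "E_inner n \<xi> \<xi> = 1" and \<xi>E: "\<xi> \<in> E_space n" using \<xi> by (auto simp: unit_sphere_iff)
  have aa: "E_inner n a a = 1" and aE: "a \<in> E_space n" using a by (auto simp: unit_sphere_iff)
  have y1: "y\<^sup>2 \<le> 1" using E_inner_Cauchy_Schwarz[of n \<xi> u] by (simp add: y_def uu \<xi>\<xi>)
  have neg': "rim_cos * y + 1/4 * E_inner n \<xi> w < 0"
    if "w \<in> unit_sphere n" "E_inner n w u = 0" for w
  proof -
    have "(\<lambda>i. rim_cos * u i + 1/4 * w i) \<in> rim n u" using that unfolding rim_def by blast
    from neg[OF this] show ?thesis by (simp add: y_def E_inner_linear)
  qed
  show ?thesis
  proof (cases "y\<^sup>2 = 1")
    case True
    have ne: "(E_inner n a u)\<^sup>2 \<noteq> E_inner n a a"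
    proof
      assume "(E_inner n a u)\<^sup>2 = E_inner n a a"
      then have "E_inner n a u = 1 \<or> E_inner n a u = - 1" using aa by (simp add: power2_eq_1_iff)
      then consider "E_inner n (\<lambda>i. a i - u i) (\<lambda>i. a i - u i) = 0"
        | "E_inner n (\<lambda>i. a i + u i) (\<lambda>i. a i + u i) = 0"
        by (auto simp: E_inner_linear aa uu E_inner_commute[of n u a])
      then show False
      proof cases
        case 1
        then have "(\<lambda>i. a i - u i) = (\<lambda>_. 0)"
          using E_inner_self_eq_0[of "\<lambda>i. a i - u i" n] aE uE by (simp add: in_E_space_iff)
        then show False using a(2) by (auto simp: fun_eq_iff)
      next
        case 2
        then have "(\<lambda>i. a i + u i) = (\<lambda>_. 0)"
          using E_inner_self_eq_0[of "\<lambda>i. a i + u i" n] aE uE by (simp add: in_E_space_iff)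
        then show False using a(3) by (auto simp: fun_eq_iff eq_neg_iff_add_eq_0)
      qed
    qed
    obtain w where w: "w \<in> unit_sphere n" "E_inner n w u = 0"
      using unit_orthogonal_component[OF u aE ne] .
    have minus: "(\<lambda>i. - w i) \<in> unit_sphere n" "E_inner n (\<lambda>i. - w i) u = 0"
      using w by (auto simp: unit_sphere_iff in_E_space_iff E_inner_linear)
    have "rim_cos * y < 0"
      using neg'[OF w] neg'[OF minus] by (simp add: E_inner_linear)
    then have "y < 0" using rim_cos_bounds(1) by (simp add: mult_less_0_iff)
    then have "y = - 1" using True by (simp add: power2_eq_1_iff)
    then show ?thesis by (simp add: y_def)
  next
    case False
    then have "(E_inner n \<xi> u)\<^sup>2 \<noteq> E_inner n \<xi> \<xi>" by (simp add: \<xi>\<xi> y_def)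
    then obtain w where w: "w \<in> unit_sphere n" "E_inner n w u = 0"
      "E_inner n \<xi> w = sqrt (1 - y\<^sup>2)"
      using unit_orthogonal_component[OF u \<xi>E] \<xi>\<xi> unfolding y_def by metis
    have less: "1/4 * sqrt (1 - y\<^sup>2) < rim_cos * (- y)" using neg'[OF w(1,2)] w(3) by simp
    then have "(1/4 * sqrt (1 - y\<^sup>2))\<^sup>2 < (rim_cos * (- y))\<^sup>2"
      using y1 by (intro power_strict_mono) auto
    then have "(1 - y\<^sup>2) / 16 < 15/16 * y\<^sup>2"
      using y1 by (simp add: power_mult_distrib rim_cos_square power_divide)
    then have "(1/4)\<^sup>2 < (- y)\<^sup>2" by (simp add: power_divide)
    moreover have "0 \<le> - y"
    proof -
      have "0 \<le> 1/4 * sqrt (1 - y\<^sup>2)" using y1 by simp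
      with less have "0 < rim_cos * (- y)" by linarith
      then show ?thesis using rim_cos_bounds(1) by (simp add: mult_less_0_iff)
    qed
    ultimately have "1/4 < - y" by (rule power_less_imp_less_base)
    then show ?thesis by (simp add: y_def)
  qed
qed

text \<open>
  The apexes \<open>3/5 u\<close>, and the points at distance 1 from them that make the rim of \<open>u\<close> consist of normals at
  \<open>3/5 u\<close>. The factor \<open>3/5\<close> must be small enough for the distances from one apex to another apex or to its
  rim points, and large enough for the distances between rim points of different apexes.
\<close>

definition apex_rim_set :: "nat \<Rightarrow> (nat \<Rightarrow> real) set \<Rightarrow> (nat \<Rightarrow> real) set" where
  "apex_rim_set n U = {(\<lambda>i. 3/5 * u i) |u. u \<in> U} \<union> {(\<lambda>i. 3/5 * u i - v i) |u v. u \<in> U \<and> v \<in> rim n u}"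

lemma apex_apex_distance:
  assumes u: "u \<in> unit_sphere n" and u': "u' \<in> unit_sphere n" and y: "- 1/3 \<le> E_inner n u u'"
  shows "E_dist n (\<lambda>i. 3/5 * u i) (\<lambda>i. 3/5 * u' i) \<le> 1"
  using assms by (simp add: E_dist_le_1_iff unit_sphere_iff E_inner_linear E_inner_commute[of n u' u])

text \<open>
  With \<open>y = \<langle>u, u'\<rangle>\<close> and \<open>q = \<langle>u, w\<rangle>\<close>, where \<open>w\<close> is the direction of \<open>v\<close> orthogonal to \<open>u'\<close>, the claim
  is \<open>q / 4 \<le> (cos \<phi> - 3/5) (1 - y)\<close>. Bessel's inequality gives \<open>q\<^sup>2 \<le> 1 - y\<^sup>2\<close>, and \<open>y \<le> 1/3\<close> turns this
  into \<open>q\<^sup>2 \<le> 2 (1 - y)\<^sup>2\<close>; since \<open>sqrt 2 / 4 < 0.368 \<le> cos \<phi> - 3/5\<close>, that is enough.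
\<close>

lemma apex_rim_distance:
  assumes u: "u \<in> unit_sphere n" and u': "u' \<in> unit_sphere n"
    and y: "u = u' \<or> \<bar>E_inner n u u'\<bar> \<le> 1/3" and v: "v \<in> rim n u'"
  shows "E_dist n (\<lambda>i. 3/5 * u i) (\<lambda>i. 3/5 * u' i - v i) \<le> 1"
proof -
  define y where "y = E_inner n u u'"
  have uu: "E_inner n u u = 1" "E_inner n u' u' = 1" using u u' by (auto simp: unit_sphere_iff)
  obtain w where w: "w \<in> unit_sphere n" "E_inner n w u' = 0" "v = (\<lambda>i. rim_cos * u' i + 1/4 * w i)"
    using v by (auto simp: rim_def)
  define q where "q = E_inner n u w"
  have ww: "E_inner n w w = 1" using w by (auto simp: unit_sphere_iff)
  have vv: "E_inner n v v = 1" using rim_unit[OF u' v] by (auto simp: unit_sphere_iff)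
  have uv: "E_inner n u v = rim_cos * y + q / 4"
    by (simp add: w(3) E_inner_linear y_def q_def)
  have u'v: "E_inner n u' v = rim_cos"
    using w(2) uu by (simp add: w(3) E_inner_linear E_inner_commute[of n u' w])
  have eq: "E_inner n (\<lambda>i. 3/5 * u i - (3/5 * u' i - v i)) (\<lambda>i. 3/5 * u i - (3/5 * u' i - v i))
      = 18/25 * (1 - y) + 1 - 6/5 * (rim_cos * (1 - y) - q / 4)"
    using uu vv uv u'v
    by (simp add: E_inner_linear E_inner_commute[of n u' u]
        E_inner_commute[of n v u] E_inner_commute[of n v u'] flip: y_def)
      (simp add: field_simps)
  have "q / 4 \<le> (rim_cos - 3/5) * (1 - y)"
  proof (cases "u = u'")
    case True
    then show ?thesis using w(2) uu by (simp add: q_def y_def E_inner_commute)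
  next
    case False
    then have yb: "\<bar>y\<bar> \<le> 1/3" using y by (simp add: y_def)
    have "(E_inner n (\<lambda>i. u i - y * u' i) w)\<^sup>2
        \<le> E_inner n (\<lambda>i. u i - y * u' i) (\<lambda>i. u i - y * u' i) * E_inner n w w"
      by (rule E_inner_Cauchy_Schwarz)
    then have "q\<^sup>2 \<le> (1 - y) * (1 + y)"
      using w(2) uu ww
      by (simp add: E_inner_linear E_inner_commute[of n u' u] E_inner_commute[of n u' w]
          q_def flip: y_def) (simp add: algebra_simps)
    also have "\<dots> \<le> (1 - y) * (2 * (1 - y))" using yb by (intro mult_left_mono) auto
    also have "\<dots> = 2 * (1 - y)\<^sup>2" by (simp add: power2_eq_square algebra_simps)
    finally have q2: "q\<^sup>2 \<le> 2 * (1 - y)\<^sup>2" .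
    have "(q / 4)\<^sup>2 = 1/16 * q\<^sup>2" by (simp add: power_divide)
    also have "\<dots> \<le> 1/16 * (2 * (1 - y)\<^sup>2)" using q2 by (rule mult_left_mono) simp
    also have "\<dots> = 1/8 * (1 - y)\<^sup>2" by simp
    also have "\<dots> \<le> (46/125)\<^sup>2 * (1 - y)\<^sup>2"
      by (rule mult_right_mono) (simp_all add: power2_eq_square)
    finally have "(q / 4)\<^sup>2 \<le> (46/125 * (1 - y))\<^sup>2" by (simp only: power_mult_distrib)
    then have "q / 4 \<le> 46/125 * (1 - y)" by (rule power2_le_imp_le) (use yb in auto)
    also have "\<dots> \<le> (rim_cos - 3/5) * (1 - y)"
      using rim_cos_bounds(1) yb by (intro mult_right_mono) auto
    finally show ?thesis .
  qed
  then have "q / 4 \<le> rim_cos * (1 - y) - 3/5 * (1 - y)" by (simp only: left_diff_distrib)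
  moreover have "18/25 * s + 1 - 6/5 * (p - z) \<le> 1" if "z \<le> p - 3/5 * s" for s p z :: real
    using that by simp
  ultimately show ?thesis unfolding E_dist_le_1_iff eq by blast
qed

text \<open>
  With \<open>m = cos \<phi> - 3/5\<close> the difference of the two points is \<open>m (u' - u) + (w' - w) / 4\<close>. As \<open>w\<close> is
  orthogonal to \<open>u\<close> and \<open>w'\<close> to \<open>u'\<close>, only two terms of the cross product survive, and crude bounds on all
  inner products suffice: \<open>m\<^sup>2 * 8/3 + 1/4 + m < 1\<close>.
\<close>

lemma rim_rim_distance:
  assumes u: "u \<in> unit_sphere n" and u': "u' \<in> unit_sphere n"
    and y: "u = u' \<or> \<bar>E_inner n u u'\<bar> \<le> 1/3" and v: "v \<in> rim n u" and v': "v' \<in> rim n u'"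
  shows "E_dist n (\<lambda>i. 3/5 * u i - v i) (\<lambda>i. 3/5 * u' i - v' i) \<le> 1"
proof -
  define y where "y = E_inner n u u'"
  define m where "m = rim_cos - 3/5"
  have m: "0 \<le> m" "m \<le> 0.3683" using rim_cos_bounds by (auto simp: m_def)
  have uu: "E_inner n u u = 1" "E_inner n u' u' = 1" using u u' by (auto simp: unit_sphere_iff)
  obtain w where w: "w \<in> unit_sphere n" "E_inner n w u = 0" "v = (\<lambda>i. rim_cos * u i + 1/4 * w i)"
    using v by (auto simp: rim_def)
  obtain w' where w': "w' \<in> unit_sphere n" "E_inner n w' u' = 0"
    "v' = (\<lambda>i. rim_cos * u' i + 1/4 * w' i)"
    using v' by (auto simp: rim_def)
  have ww: "E_inner n w w = 1" "E_inner n w' w' = 1" using w w' by (auto simp: unit_sphere_iff)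
  define z where "z = E_inner n w w'"
  define p where "p = E_inner n u w'"
  define q where "q = E_inner n u' w"
  have b: "\<bar>z\<bar> \<le> 1" "\<bar>p\<bar> \<le> 1" "\<bar>q\<bar> \<le> 1"
    unfolding z_def p_def q_def using uu ww by (auto intro!: E_inner_le_1)
  define d where "d = (\<lambda>i. m * u' i - m * u i + 1/4 * w' i - 1/4 * w i)"
  have "(\<lambda>i. 3/5 * u i - v i - (3/5 * u' i - v' i)) = d"
    by (auto simp: w(3) w'(3) d_def m_def algebra_simps)
  moreover have "E_inner n d d = m\<^sup>2 * (2 * (1 - y)) + (1 - z) / 8 - m * (p + q) / 2"
    using uu ww w(2) w'(2)
    by (simp add: d_def E_inner_linear E_inner_commute[of n u' u] E_inner_commute[of n w' w]
        E_inner_commute[of n w u] E_inner_commute[of n w u'] E_inner_commute[of n w' u]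
        E_inner_commute[of n w' u'] flip: y_def z_def p_def q_def)
      (simp add: field_simps power2_eq_square)
  moreover have "m\<^sup>2 * (2 * (1 - y)) + (1 - z) / 8 - m * (p + q) / 2 \<le> 1"
  proof (cases "u = u'")
    case True
    then have "y = 1" "p = 0" "q = 0"
      using uu w(2) w'(2) by (simp_all add: y_def p_def q_def E_inner_commute)
    then show ?thesis using b by simp
  next
    case False
    then have yb: "2 * (1 - y) \<le> 8/3" "0 \<le> 2 * (1 - y)" using y by (auto simp: y_def)
    have "m\<^sup>2 \<le> 0.3683\<^sup>2" using m by (intro power_mono) auto
    then have "m\<^sup>2 * (2 * (1 - y)) \<le> 0.3683\<^sup>2 * (8/3)" using yb by (intro mult_mono) auto
    moreover have "m * (- (p + q)) \<le> m * 2" using m b by (intro mult_left_mono) auto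
    then have "- (m * (p + q)) \<le> 0.3683 * 2" using m by (simp add: algebra_simps)
    moreover have "(1 - z) / 8 \<le> 1/4" using b by simp
    moreover have "a + b - c / 2 \<le> 1"
      if "a \<le> 0.3683\<^sup>2 * (8/3)" "- c \<le> 0.3683 * 2" "b \<le> 1/4" for a b c :: real
      using that by (simp add: power2_eq_square)
    ultimately show ?thesis by blast
  qed
  ultimately show ?thesis by (simp add: E_dist_le_1_iff)
qed

lemma apex_rim_set_diameter:
  assumes U: "U \<subseteq> unit_sphere n"
    and sep: "\<And>u v. u \<in> U \<Longrightarrow> v \<in> U \<Longrightarrow> u \<noteq> v \<Longrightarrow> \<bar>E_inner n u v\<bar> \<le> 1/3"
  shows "diameter_le_1 n (apex_rim_set n U)"
  unfolding diameter_le_1_def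
proof (intro conjI ballI)
  show "apex_rim_set n U \<subseteq> E_space n"
  proof
    fix a assume "a \<in> apex_rim_set n U"
    then consider u where "u \<in> U" "a = (\<lambda>i. 3/5 * u i)"
      | u v where "u \<in> U" "v \<in> rim n u" "a = (\<lambda>i. 3/5 * u i - v i)"
      unfolding apex_rim_set_def by blast
    then show "a \<in> E_space n"
    proof cases
      case 1
      then show ?thesis using U by (auto simp: unit_sphere_iff in_E_space_iff)
    next
      case 2
      then have "u \<in> unit_sphere n" using U by blast
      with rim_unit[OF this 2(2)] 2(3) show ?thesis by (simp add: unit_sphere_iff in_E_space_iff)
    qed
  qed
  have sep': "u = u' \<or> \<bar>E_inner n u u'\<bar> \<le> 1/3" if "u \<in> U" "u' \<in> U" for u u'
    using sep that by blast
  fix a b assume "a \<in> apex_rim_set n U" "b \<in> apex_rim_set n U"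
  then consider u u' where "u \<in> U" "u' \<in> U" "a = (\<lambda>i. 3/5 * u i)" "b = (\<lambda>i. 3/5 * u' i)"
    | u u' v where "u \<in> U" "u' \<in> U" "a = (\<lambda>i. 3/5 * u i)" "b = (\<lambda>i. 3/5 * u' i - v i)" "v \<in> rim n u'"
    | u u' v where "u \<in> U" "u' \<in> U" "b = (\<lambda>i. 3/5 * u i)" "a = (\<lambda>i. 3/5 * u' i - v i)" "v \<in> rim n u'"
    | u u' v v' where "u \<in> U" "u' \<in> U" "a = (\<lambda>i. 3/5 * u i - v i)" "v \<in> rim n u"
      "b = (\<lambda>i. 3/5 * u' i - v' i)" "v' \<in> rim n u'"
    unfolding apex_rim_set_def by blast
  then show "E_dist n a b \<le> 1"
  proof cases
    case 1
    have "- 1/3 \<le> E_inner n u u'"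
      using sep'[OF 1(1,2)] U 1(1) by (auto simp: unit_sphere_iff subset_iff)
    then show ?thesis using 1 U apex_apex_distance by blast
  next
    case 2
    then show ?thesis using U sep'[OF 2(1,2)] apex_rim_distance by blast
  next
    case 3
    have "E_dist n b a \<le> 1" using 3 U sep'[OF 3(1,2)] apex_rim_distance by blast
    then show ?thesis by (simp only: Metric_space.commute[OF E_metric, of n a b])
  next
    case 4
    then show ?thesis using U sep'[OF 4(1,2)] rim_rim_distance by blast
  qed
qed

text \<open>
  Complete the set of apexes and rim points. A direction \<open>\<xi>\<close> that illuminates the apex \<open>3/5 u\<close> has negative
  inner product with the rim of \<open>u\<close>, so \<open>u\<close> lies in the cap around \<open>-\<xi>\<close>. Since \<open>M\<close> caps leave out some axis,
  \<open>M\<close> directions leave out some apex.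
\<close>

lemma constant_width_body_of_cap_resistant:
  assumes n: "n \<ge> 1" and M: "M \<ge> 1" and res: "cap_resistant n M U"
  obtains K where "convex_body n K" "constant_width n K" "M < illumination_number n K"
proof -
  have U: "U \<subseteq> unit_sphere n"
    and sep: "\<And>u v. u \<in> U \<Longrightarrow> v \<in> U \<Longrightarrow> u \<noteq> v \<Longrightarrow> \<bar>E_inner n u v\<bar> \<le> 1/3"
    and caps: "\<And>\<Xi>. finite \<Xi> \<Longrightarrow> \<Xi> \<subseteq> unit_sphere n \<Longrightarrow> card \<Xi> \<le> M \<Longrightarrow>
      \<exists>u\<in>U. \<forall>\<xi>\<in>\<Xi>. E_inner n \<xi> u < 1/4"
    using res by (simp_all add: cap_resistant_def)
  obtain K where sub: "apex_rim_set n U \<subseteq> K" and K: "diametrically_complete n K"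
    using diametric_completion[OF apex_rim_set_diameter[OF U sep]] .
  have apex: "(\<lambda>i. 3/5 * u i) \<in> K" if "u \<in> U" for u
    using sub that unfolding apex_rim_set_def by blast
  have rim_pt: "(\<lambda>i. 3/5 * u i - v i) \<in> K" if "u \<in> U" "v \<in> rim n u" for u v
    using sub that unfolding apex_rim_set_def by blast
  \<comment> \<open>The single cap around \<open>u\<close> does not cover the axes.\<close>
  have other: "\<exists>u'\<in>U. u' \<noteq> u \<and> u' \<noteq> (\<lambda>i. - u i)" if u: "u \<in> U" for u
  proof -
    obtain u' where u': "u' \<in> U" "E_inner n u u' < 1/4"
      using caps[of "{u}"] u U M by auto
    have uu: "E_inner n u u = 1" using u U by (auto simp: unit_sphere_iff)
    then have "u' \<noteq> u" using u' by auto
    moreover have "u' \<noteq> (\<lambda>i. - u i)"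
      using sep[OF u u'(1)] \<open>u' \<noteq> u\<close> uu by (auto simp: E_inner_linear)
    ultimately show ?thesis using u' by blast
  qed
  have rim_ne: "\<exists>v. v \<in> rim n u" if u: "u \<in> U" for u
  proof (rule ccontr)
    obtain u' where u': "u' \<in> U" "u' \<noteq> u" "u' \<noteq> (\<lambda>i. - u i)" using other[OF u] by blast
    assume "\<nexists>v. v \<in> rim n u"
    then have "E_inner n u u \<le> - 1/4"
      using u u' U by (intro rim_meets_halfspace[of u n u' u]) auto
    then show False using u U by (auto simp: unit_sphere_iff)
  qed
  have front: "(\<lambda>i. 3/5 * u i) \<in> Euclidean_space n frontier_of K" if u: "u \<in> U" for u
  proof -
    obtain v where v: "v \<in> rim n u" using rim_ne[OF u] by blast
    have "u \<in> unit_sphere n" using u U by blast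
    then show ?thesis
      using far_point_in_frontier[OF K apex[OF u] rim_unit[OF _ v] rim_pt[OF u v]] by blast
  qed
  obtain u where u: "u \<in> U" using caps[of "{}"] by auto
  obtain u' where u': "u' \<in> U" "u' \<noteq> u" using other[OF u] by blast
  have "(\<lambda>i. 3/5 * u i) \<noteq> (\<lambda>i. 3/5 * u' i)" using u'(2) by (auto simp: fun_eq_iff eq_commute)
  note body = complete_convex_body[OF K apex[OF u] apex[OF u'(1)] this]
  have "M < illumination_number n K"
  proof (rule illumination_number_greater[OF body(1) n])
    fix \<Xi> assume \<Xi>: "finite \<Xi>" "\<Xi> \<subseteq> unit_sphere n" "card \<Xi> \<le> M"
    define \<Xi>' where "\<Xi>' = (\<lambda>\<xi>. (\<lambda>i. - \<xi> i :: real)) ` \<Xi>"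
    have "\<Xi>' \<subseteq> unit_sphere n"
      using \<Xi>(2) by (auto simp: \<Xi>'_def unit_sphere_iff in_E_space_iff E_inner_linear subset_iff)
    moreover have "finite \<Xi>'" "card \<Xi>' \<le> M"
      using \<Xi> card_image_le[OF \<Xi>(1)] unfolding \<Xi>'_def by (auto intro: order_trans)
    ultimately obtain w where w: "w \<in> U" "\<forall>\<xi>\<in>\<Xi>'. E_inner n \<xi> w < 1/4"
      using caps by blast
    have "\<not> illuminates n K \<xi> (\<lambda>i. 3/5 * w i)" if \<xi>: "\<xi> \<in> \<Xi>" for \<xi>
    proof
      assume ill: "illuminates n K \<xi> (\<lambda>i. 3/5 * w i)"
      obtain a where a: "a \<in> U" "a \<noteq> w" "a \<noteq> (\<lambda>i. - w i)" using other[OF w(1)] by blast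
      have wS: "w \<in> unit_sphere n" using w U by blast
      have "E_inner n \<xi> w \<le> - 1/4"
      proof (rule rim_meets_halfspace[OF wS _ a(2,3)])
        show "a \<in> unit_sphere n" "\<xi> \<in> unit_sphere n" using a \<xi> U \<Xi> by auto
        show "E_inner n \<xi> v < 0" if "v \<in> rim n w" for v
          using illuminates_far_point[OF K apex[OF w(1)] rim_unit[OF wS that] rim_pt[OF w(1) that] ill] .
      qed
      moreover have "E_inner n (\<lambda>i. - \<xi> i) w < 1/4" using w(2) \<xi> by (auto simp: \<Xi>'_def)
      ultimately show False by (simp add: E_inner_linear)
    qed
    then show "\<exists>x\<in>Euclidean_space n frontier_of K. \<forall>\<xi>\<in>\<Xi>. \<not> illuminates n K \<xi> x"
      using front[OF w(1)] by blast
  qed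
  with body show thesis by (rule that)
qed

text \<open>
  For small \<open>n\<close> a completion of two points at distance 1 is enough; having a boundary point,
  it cannot be illuminated by no direction at all.
\<close>

lemma constant_width_body_exists:
  assumes n: "n \<ge> 1"
  obtains K where "convex_body n K" "constant_width n K" "0 < illumination_number n K"
proof -
  obtain e where e: "e \<in> unit_sphere n" using exists_unit_vector[OF n] .
  have eE: "e \<in> E_space n" and ee: "E_inner n e e = 1" using e by (auto simp: unit_sphere_iff)
  let ?o = "\<lambda>_::nat. 0::real"
  have "diameter_le_1 n {?o, e}"
    using eE ee by (simp add: diameter_le_1_def E_dist_le_1_iff in_E_space_iff E_inner_linear)
      (simp add: E_inner_def)
  then obtain K where K: "{?o, e} \<subseteq> K" "diametrically_complete n K"
    using diametric_completion by blast
  have "e \<noteq> ?o" using ee by (auto simp: E_inner_def)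
  then have body: "convex_body n K" "constant_width n K"
    using complete_convex_body[OF K(2), of e ?o] K(1) by auto
  have front: "e \<in> Euclidean_space n frontier_of K"
    using K e by (intro far_point_in_frontier[of n K e e]) auto
  have "0 < illumination_number n K"
  proof (rule illumination_number_greater[OF body(1) n])
    fix \<Xi> :: "(nat \<Rightarrow> real) set" assume "finite \<Xi>" "card \<Xi> \<le> 0"
    then show "\<exists>x\<in>Euclidean_space n frontier_of K. \<forall>\<xi>\<in>\<Xi>. \<not> illuminates n K \<xi> x"
      using front by auto
  qed
  with body show thesis by (rule that)
qed

section \<open>Caps of sign vectors\<close>

lemma sinh_le_self_mult_cosh:
  fixes x :: real
  assumes "0 \<le> x"
  shows "sinh x \<le> x * cosh x"
proof -
  have "(\<lambda>x. x * cosh x - sinh x) 0 \<le> (\<lambda>x::real. x * cosh x - sinh x) x"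
  proof (rule DERIV_nonneg_imp_nondecreasing[OF assms])
    fix t :: real assume "0 \<le> t"
    have "((\<lambda>x. x * cosh x - sinh x) has_real_derivative t * sinh t) (at t)"
      by (auto intro!: derivative_eq_intros)
    moreover have "0 \<le> t * sinh t" using \<open>0 \<le> t\<close> by simp
    ultimately show "\<exists>y. ((\<lambda>x. x * cosh x - sinh x) has_real_derivative y) (at t) \<and> 0 \<le> y" by blast
  qed
  then show ?thesis by simp
qed

text \<open>
  The quotient \<open>exp (- x\<^sup>2 / 2) cosh x\<close> decreases for \<open>x \<ge> 0\<close>, because \<open>sinh x \<le> x cosh x\<close>.
\<close>

lemma cosh_le_exp_half_square: "cosh (x::real) \<le> exp (x\<^sup>2 / 2)"
proof -
  have *: "cosh x \<le> exp (x\<^sup>2 / 2)" if "0 \<le> x" for x :: real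
  proof -
    have "(\<lambda>x. exp (- (x\<^sup>2 / 2)) * cosh x) x \<le> (\<lambda>x::real. exp (- (x\<^sup>2 / 2)) * cosh x) 0"
    proof (rule DERIV_nonpos_imp_nonincreasing[OF that])
      fix t :: real assume t: "0 \<le> t"
      have "((\<lambda>x. exp (- (x\<^sup>2 / 2)) * cosh x) has_real_derivative
          exp (- (t\<^sup>2 / 2)) * (sinh t - t * cosh t)) (at t)"
        by (auto intro!: derivative_eq_intros simp: algebra_simps)
      moreover have "exp (- (t\<^sup>2 / 2)) * (sinh t - t * cosh t) \<le> 0"
        using sinh_le_self_mult_cosh[OF t] by (simp add: mult_le_0_iff)
      ultimately show "\<exists>y. ((\<lambda>x. exp (- (x\<^sup>2 / 2)) * cosh x) has_real_derivative y) (at t) \<and> y \<le> 0"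
        by blast
    qed
    then show ?thesis by (simp add: exp_minus field_simps)
  qed
  show ?thesis using *[of "\<bar>x\<bar>"] by simp
qed

text \<open>
  These are \<open>sqrt n\<close> times the candidates for axes. Outside \<open>{..<n}\<close> a sign vector is \<open>undefined\<close>
  rather than 0, which \<open>E_inner n\<close> does not see.
\<close>

definition signs :: "nat \<Rightarrow> (nat \<Rightarrow> real) set" where
  "signs n = (\<Pi>\<^sub>E i\<in>{..<n}. {-1, 1})"

lemma finite_signs: "finite (signs n)"
  by (auto simp: signs_def intro!: finite_PiE)

lemma card_signs: "card (signs n) = 2 ^ n"
  by (simp add: signs_def card_PiE numeral_2_eq_2)

lemma E_inner_signs_self: "\<epsilon> \<in> signs n \<Longrightarrow> E_inner n \<epsilon> \<epsilon> = n"
proof -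
  assume "\<epsilon> \<in> signs n"
  then have "\<epsilon> i * \<epsilon> i = 1" if "i < n" for i
    using that by (force simp: signs_def PiE_iff)
  then show ?thesis by (simp add: E_inner_def)
qed

lemma sum_exp_signs: "(\<Sum>\<epsilon>\<in>signs n. exp (E_inner n \<epsilon> a)) = 2 ^ n * (\<Prod>i<n. cosh (a i))"
proof -
  have "(\<Sum>\<epsilon>\<in>signs n. exp (E_inner n \<epsilon> a)) = (\<Sum>\<epsilon>\<in>signs n. \<Prod>i<n. exp (\<epsilon> i * a i))"
    by (simp add: E_inner_def exp_sum)
  also have "\<dots> = (\<Prod>i<n. \<Sum>s\<in>{-1, 1}. exp (s * a i))"
    unfolding signs_def by (subst prod_sum_PiE) auto
  also have "\<dots> = (\<Prod>i<n. 2 * cosh (a i))"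
    by (intro prod.cong) (auto simp: cosh_field_def)
  finally show ?thesis by (simp add: prod.distrib)
qed

text \<open>
  Chernoff's bound. The mean of \<open>exp (T \<langle>\<epsilon>, a\<rangle>)\<close> over all sign vectors is a product of hyperbolic
  cosines, hence at most \<open>exp (T\<^sup>2 / 2)\<close>, while each \<open>\<epsilon>\<close> in the cap contributes at least \<open>exp (T\<^sup>2)\<close>.
\<close>

lemma card_signs_cap:
  assumes a: "E_inner n a a \<le> 1" and T: "0 \<le> T"
  shows "real (card {\<epsilon> \<in> signs n. T \<le> E_inner n \<epsilon> a}) \<le> 2 ^ n * exp (- T\<^sup>2 / 2)"
proof -
  let ?C = "{\<epsilon> \<in> signs n. T \<le> E_inner n \<epsilon> a}"
  have "real (card ?C) * exp (T * T) = (\<Sum>\<epsilon>\<in>?C. exp (T * T))" by simp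
  also have "\<dots> \<le> (\<Sum>\<epsilon>\<in>?C. exp (E_inner n \<epsilon> (\<lambda>i. T * a i)))"
    using T by (intro sum_mono) (simp add: E_inner_linear mult_left_mono)
  also have "\<dots> \<le> (\<Sum>\<epsilon>\<in>signs n. exp (E_inner n \<epsilon> (\<lambda>i. T * a i)))"
    using finite_signs by (intro sum_mono2) auto
  also have "\<dots> = 2 ^ n * (\<Prod>i<n. cosh (T * a i))" by (rule sum_exp_signs)
  also have "\<dots> \<le> 2 ^ n * (\<Prod>i<n. exp ((T * a i)\<^sup>2 / 2))"
    by (intro mult_left_mono prod_mono) (auto simp: cosh_le_exp_half_square)
  also have "(\<Prod>i<n. exp ((T * a i)\<^sup>2 / 2)) = exp (T\<^sup>2 / 2 * E_inner n a a)"
    by (simp add: E_inner_def power_mult_distrib sum_distrib_left power2_eq_square mult_ac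
        flip: exp_sum)
  also have "\<dots> \<le> exp (T\<^sup>2 / 2)" using mult_left_mono[OF a, of "T\<^sup>2 / 2"] by simp
  finally have "real (card ?C) * exp (T * T) \<le> 2 ^ n * exp (T\<^sup>2 / 2)" by simp
  then have "real (card ?C) \<le> 2 ^ n * exp (T\<^sup>2 / 2) / exp (T * T)" by (simp add: field_simps)
  also have "\<dots> = 2 ^ n * exp (T\<^sup>2 / 2 - T * T)" by (simp add: exp_diff)
  also have "T\<^sup>2 / 2 - T * T = - T\<^sup>2 / 2" by (simp add: power2_eq_square)
  finally show ?thesis .
qed

lemma card_signs_correlated:
  assumes b: "b \<in> signs n" and n: "n \<ge> 1"
  shows "real (card {\<epsilon> \<in> signs n. n / 3 < \<bar>E_inner n \<epsilon> b\<bar>}) \<le> 2 * exp (- n / 18) * 2 ^ n"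
proof -
  define T where "T = sqrt n / 3"
  have T: "0 \<le> T" "- T\<^sup>2 / 2 = - n / 18" by (simp_all add: T_def power_divide)
  have half: "real (card {\<epsilon> \<in> signs n. n / 3 \<le> s * E_inner n \<epsilon> b}) \<le> 2 ^ n * exp (- n / 18)"
    if s: "s * s = 1" for s :: real
  proof -
    have "E_inner n (\<lambda>i. s * b i / sqrt n) (\<lambda>i. s * b i / sqrt n) \<le> 1"
      using s n by (simp add: E_inner_linear E_inner_signs_self[OF b])
    from card_signs_cap[OF this T(1)]
    have "real (card {\<epsilon> \<in> signs n. T \<le> s * E_inner n \<epsilon> b / sqrt n}) \<le> 2 ^ n * exp (- n / 18)"
      by (simp only: E_inner_linear T(2))
    moreover have "T \<le> z / sqrt n \<longleftrightarrow> n / 3 \<le> z" for z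
      using n by (simp add: T_def field_simps)
    ultimately show ?thesis by simp
  qed
  have "{\<epsilon> \<in> signs n. n / 3 < \<bar>E_inner n \<epsilon> b\<bar>} \<subseteq>
      {\<epsilon> \<in> signs n. n / 3 \<le> 1 * E_inner n \<epsilon> b} \<union> {\<epsilon> \<in> signs n. n / 3 \<le> (- 1) * E_inner n \<epsilon> b}"
    by auto
  then have "card {\<epsilon> \<in> signs n. n / 3 < \<bar>E_inner n \<epsilon> b\<bar>} \<le>
      card {\<epsilon> \<in> signs n. n / 3 \<le> 1 * E_inner n \<epsilon> b} + card {\<epsilon> \<in> signs n. n / 3 \<le> (- 1) * E_inner n \<epsilon> b}"
    using finite_signs by (intro order_trans[OF card_mono card_Un_le]) auto
  then have "real (card {\<epsilon> \<in> signs n. n / 3 < \<bar>E_inner n \<epsilon> b\<bar>}) \<le>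
      real (card {\<epsilon> \<in> signs n. n / 3 \<le> 1 * E_inner n \<epsilon> b}) +
      real (card {\<epsilon> \<in> signs n. n / 3 \<le> (- 1) * E_inner n \<epsilon> b})"
    by linarith
  also have "\<dots> \<le> 2 ^ n * exp (- n / 18) + 2 ^ n * exp (- n / 18)"
    by (intro add_mono half) auto
  finally show ?thesis by (simp add: mult_ac)
qed

section \<open>Rounding directions to a grid\<close>

text \<open>
  The directions form a continuum, but the union bound needs finitely many caps. Keeping only grid
  vectors of norm at most 1 makes Chernoff's bound applicable to them.
\<close>

definition grid :: "nat \<Rightarrow> (nat \<Rightarrow> real) set" where
  "grid n = {g \<in> \<Pi>\<^sub>E i\<in>{..<n}. (\<lambda>k. of_int k / n) ` {- int n..int n}. E_inner n g g \<le> 1}"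

lemma finite_grid: "finite (grid n)"
proof -
  have "finite (\<Pi>\<^sub>E i\<in>{..<n}. (\<lambda>k. real_of_int k / n) ` {- int n..int n})"
    by (intro finite_PiE) auto
  then show ?thesis unfolding grid_def by (rule rev_finite_subset) blast
qed

lemma card_grid: "card (grid n) \<le> (2 * n + 1) ^ n"
proof -
  have "card (grid n) \<le> card (\<Pi>\<^sub>E i\<in>{..<n}. (\<lambda>k. real_of_int k / n) ` {- int n..int n})"
    unfolding grid_def by (intro card_mono finite_PiE) auto
  also have "\<dots> = card ((\<lambda>k. real_of_int k / n) ` {- int n..int n}) ^ n"
    by (simp add: card_PiE)
  also have "\<dots> \<le> card {- int n..int n} ^ n"
    by (intro power_mono card_image_le) auto
  also have "card {- int n..int n} = 2 * n + 1" by simp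
  finally show ?thesis .
qed

lemma round_towards_zero:
  fixes x :: real
  assumes n: "n \<ge> 1" and x: "\<bar>x\<bar> \<le> 1"
  obtains k where "k \<in> {- int n..int n}" "\<bar>of_int k / n\<bar> \<le> \<bar>x\<bar>" "\<bar>x - of_int k / n\<bar> \<le> 1 / n"
proof -
  have pos: "\<exists>k. k \<in> {0..int n} \<and> of_int k / n \<le> y \<and> y - of_int k / n \<le> 1 / n"
    if y: "0 \<le> y" "y \<le> 1" for y :: real
  proof (intro exI conjI)
    have le: "of_int \<lfloor>n * y\<rfloor> \<le> n * y" "n * y < of_int \<lfloor>n * y\<rfloor> + 1" by linarith+
    have "n * y \<le> n" using y n by (simp add: mult_left_le)
    then have "of_int \<lfloor>n * y\<rfloor> \<le> real n" using le by linarith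
    then have "\<lfloor>n * y\<rfloor> \<le> int n" by linarith
    then show "\<lfloor>n * y\<rfloor> \<in> {0..int n}" using y n by simp
    show "of_int \<lfloor>n * y\<rfloor> / n \<le> y" using le n by (simp add: field_simps)
    have "y \<le> (of_int \<lfloor>n * y\<rfloor> + 1) / n"
      using le n by (simp add: pos_le_divide_eq mult.commute)
    then show "y - of_int \<lfloor>n * y\<rfloor> / n \<le> 1 / n" by (simp add: add_divide_distrib)
  qed
  show thesis
  proof (cases "0 \<le> x")
    case True
    then obtain k where "k \<in> {0..int n}" "of_int k / n \<le> x" "x - of_int k / n \<le> 1 / n"
      using pos[of x] x by auto
    then show thesis using True by (intro that[of k]) auto
  next
    case False
    then obtain k where "k \<in> {0..int n}" "of_int k / n \<le> - x" "- x - of_int k / n \<le> 1 / n"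
      using pos[of "- x"] x by auto
    then show thesis using False by (intro that[of "- k"]) auto
  qed
qed

text \<open>
  Rounding towards zero does not increase the norm, and changes each of the \<open>n\<close> coordinates by at most \<open>1/n\<close>,
  so that inner products with sign vectors change by at most 1.
\<close>

lemma grid_approximation:
  assumes n: "n \<ge> 1" and \<xi>: "\<xi> \<in> unit_sphere n"
  obtains g where "g \<in> grid n" "\<And>\<epsilon>. \<epsilon> \<in> signs n \<Longrightarrow> E_inner n \<epsilon> \<xi> - 1 \<le> E_inner n \<epsilon> g"
proof -
  have \<xi>\<xi>: "E_inner n \<xi> \<xi> = 1" using \<xi> by (simp add: unit_sphere_iff)
  have "\<bar>\<xi> i\<bar> \<le> 1" if "i < n" for i
  proof -
    have "\<xi> i * \<xi> i \<le> E_inner n \<xi> \<xi>"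
      unfolding E_inner_def using that by (intro member_le_sum[of i "{..<n}" "\<lambda>i. \<xi> i * \<xi> i"]) auto
    then have "(\<xi> i)\<^sup>2 \<le> 1" by (simp add: \<xi>\<xi> power2_eq_square)
    then show ?thesis by (simp add: abs_square_le_1)
  qed
  then have "\<forall>i\<in>{..<n}. \<exists>k. k \<in> {- int n..int n} \<and> \<bar>of_int k / n\<bar> \<le> \<bar>\<xi> i\<bar> \<and> \<bar>\<xi> i - of_int k / n\<bar> \<le> 1 / n"
    using round_towards_zero[OF n] by (metis lessThan_iff)
  then obtain k where k: "\<forall>i\<in>{..<n}. k i \<in> {- int n..int n} \<and> \<bar>of_int (k i) / n\<bar> \<le> \<bar>\<xi> i\<bar>
      \<and> \<bar>\<xi> i - of_int (k i) / n\<bar> \<le> 1 / n"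
    using bchoice[of "{..<n}" "\<lambda>i k. k \<in> {- int n..int n} \<and> \<bar>of_int k / n\<bar> \<le> \<bar>\<xi> i\<bar> \<and> \<bar>\<xi> i - of_int k / n\<bar> \<le> 1 / n"]
    by blast
  define g where "g = (\<lambda>i\<in>{..<n}. of_int (k i) / real n)"
  have g: "\<bar>g i\<bar> \<le> \<bar>\<xi> i\<bar>" "\<bar>\<xi> i - g i\<bar> \<le> 1 / n" if "i < n" for i
    using k that by (auto simp: g_def)
  have "E_inner n g g \<le> E_inner n \<xi> \<xi>"
    unfolding E_inner_def using g(1) by (intro sum_mono) (auto simp: abs_le_square_iff power2_eq_square)
  then have "g \<in> grid n"
    using k by (auto simp: grid_def g_def \<xi>\<xi>)
  moreover have "E_inner n \<epsilon> \<xi> - 1 \<le> E_inner n \<epsilon> g" if \<epsilon>: "\<epsilon> \<in> signs n" for \<epsilon>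
  proof -
    have "E_inner n \<epsilon> \<xi> - E_inner n \<epsilon> g = (\<Sum>i<n. \<epsilon> i * (\<xi> i - g i))"
      by (simp add: E_inner_def sum_subtractf algebra_simps)
    also have "\<dots> \<le> (\<Sum>i<n. 1 / real n)"
    proof (rule sum_mono)
      fix i assume "i \<in> {..<n}"
      then have "\<epsilon> i = - 1 \<or> \<epsilon> i = 1" "\<bar>\<xi> i - g i\<bar> \<le> 1 / n" using \<epsilon> g(2) by (auto simp: signs_def PiE_iff)
      then show "\<epsilon> i * (\<xi> i - g i) \<le> 1 / real n" by auto
    qed
    also have "\<dots> = 1" using n by simp
    finally show ?thesis by simp
  qed
  ultimately show thesis by (rule that)
qed

section \<open>Existence of well spread axes\<close>

text \<open>
  The union bound for one pair of positions: once all entries except the one at \<open>i\<close> are fixed, at most a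
  fraction \<open>\<alpha>\<close> of the values at \<open>i\<close> stands in the relation \<open>P\<close> to the entry at \<open>j\<close>.
\<close>

lemma card_tuples_pair:
  fixes \<alpha> :: real
  assumes I: "finite I" "i \<in> I" "j \<in> I" "i \<noteq> j" and Q: "finite Q"
    and few: "\<And>b. b \<in> Q \<Longrightarrow> real (card {a \<in> Q. P a b}) \<le> \<alpha> * card Q"
  shows "real (card {f \<in> \<Pi>\<^sub>E k\<in>I. Q. P (f i) (f j)}) \<le> \<alpha> * real (card Q) ^ card I"
proof -
  define R where "R = (\<Pi>\<^sub>E k\<in>I - {i}. Q)"
  define S where "S = (SIGMA g:R. {a \<in> Q. P a (g j)})"
  have finR: "finite R" unfolding R_def using I Q by (intro finite_PiE) auto
  have "{f \<in> \<Pi>\<^sub>E k\<in>I. Q. P (f i) (f j)} \<subseteq> (\<lambda>(g, a). g(i := a)) ` S"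
  proof
    fix f assume f: "f \<in> {f \<in> \<Pi>\<^sub>E k\<in>I. Q. P (f i) (f j)}"
    have "(restrict f (I - {i}), f i) \<in> S"
      using f I by (auto simp: S_def R_def)
    moreover have "f = (restrict f (I - {i}))(i := f i)"
      using f I by (auto simp: fun_eq_iff PiE_iff extensional_def)
    ultimately show "f \<in> (\<lambda>(g, a). g(i := a)) ` S" by force
  qed
  moreover have finS: "finite S" unfolding S_def using finR Q by auto
  ultimately have "card {f \<in> \<Pi>\<^sub>E k\<in>I. Q. P (f i) (f j)} \<le> card S"
    by (meson card_image_le card_mono finite_imageI order_trans)
  also have "card S = (\<Sum>g\<in>R. card {a \<in> Q. P a (g j)})"
    unfolding S_def using finR Q by (intro card_SigmaI) auto
  finally have "real (card {f \<in> \<Pi>\<^sub>E k\<in>I. Q. P (f i) (f j)}) \<le> (\<Sum>g\<in>R. real (card {a \<in> Q. P a (g j)}))"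
    unfolding of_nat_sum[symmetric] of_nat_le_iff .
  also have "\<dots> \<le> (\<Sum>g\<in>R. \<alpha> * card Q)"
    using I by (intro sum_mono few) (auto simp: R_def)
  also have "\<dots> = \<alpha> * (card Q * real (card Q) ^ card (I - {i}))"
    using I by (simp add: R_def card_PiE)
  also have "card Q * real (card Q) ^ card (I - {i}) = real (card Q) ^ card I"
    using I by (metis card_Suc_Diff1 power_Suc)
  finally show ?thesis .
qed

text \<open>
  The union bound. Choose an \<open>N\<close>-tuple in \<open>Q\<close> uniformly at random. The first summand bounds the probability
  that two entries are related by \<open>P\<close>. For a fixed choice of \<open>M\<close> sets \<open>A g\<close> the probability that their union
  contains the whole tuple is at most \<open>(M \<beta>)^N\<close>, and there are \<open>(card G)^M\<close> choices.
\<close>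

lemma exists_separated_uncovered_tuple:
  fixes \<alpha> \<beta> :: real
  assumes Q: "finite Q" "Q \<noteq> {}" and G: "finite G" and N: "N \<ge> 1"
    and pair: "\<And>b. b \<in> Q \<Longrightarrow> real (card {a \<in> Q. P a b}) \<le> \<alpha> * card Q"
    and cap: "\<And>g. g \<in> G \<Longrightarrow> A g \<subseteq> Q" "\<And>g. g \<in> G \<Longrightarrow> real (card (A g)) \<le> \<beta> * card Q"
    and less: "real N ^ 2 * \<alpha> + real (card G) ^ M * (M * \<beta>) ^ N < 1"
  obtains f where "f \<in> {..<N} \<rightarrow> Q" "\<And>i j. i < N \<Longrightarrow> j < N \<Longrightarrow> i \<noteq> j \<Longrightarrow> \<not> P (f i) (f j)"
    "\<And>\<Gamma>. \<Gamma> \<subseteq> G \<Longrightarrow> card \<Gamma> \<le> M \<Longrightarrow> \<exists>i<N. \<forall>g\<in>\<Gamma>. f i \<notin> A g"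
proof -
  define \<Omega> where "\<Omega> = (\<Pi>\<^sub>E k\<in>{..<N}. Q)"
  define q where "q = real (card Q)"
  have q: "q > 0" using Q by (simp add: q_def card_gt_0_iff)
  have fin\<Omega>: "finite \<Omega>" using Q by (auto simp: \<Omega>_def intro!: finite_PiE)
  have card\<Omega>: "real (card \<Omega>) = q ^ N" by (simp add: \<Omega>_def card_PiE q_def)
  obtain b where "b \<in> Q" using Q by blast
  have "0 \<le> \<alpha> * q" using pair[OF \<open>b \<in> Q\<close>] by (metis of_nat_0_le_iff order_trans q_def)
  then have \<alpha>: "0 \<le> \<alpha>" using q by (simp add: zero_le_mult_iff)
  define D where "D = {(i, j). i < N \<and> j < N \<and> i \<noteq> j}"
  \<comment> \<open>The tuples with a related pair, and those covered by some choice of \<open>M\<close> sets.\<close>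
  define B1 where "B1 = (\<Union>(i, j)\<in>D. {f \<in> \<Omega>. P (f i) (f j)})"
  define F where "F = (\<Pi>\<^sub>E m\<in>{..<M}. G)"
  define C where "C \<phi> = (\<Union>m<M. A (\<phi> m))" for \<phi>
  define B2 where "B2 = (\<Union>\<phi>\<in>F. \<Pi>\<^sub>E k\<in>{..<N}. C \<phi>)"
  have D: "D \<subseteq> {..<N} \<times> {..<N}" by (auto simp: D_def)
  then have finD: "finite D" by (rule finite_subset) auto
  have "card D \<le> card ({..<N} \<times> {..<N})" using D by (intro card_mono) auto
  then have "card D \<le> N ^ 2" by (simp add: power2_eq_square)
  then have cardD: "real (card D) \<le> real N ^ 2" by (metis of_nat_le_iff of_nat_power)
  have "card B1 \<le> (\<Sum>p\<in>D. card (case p of (i, j) \<Rightarrow> {f \<in> \<Omega>. P (f i) (f j)}))"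
    unfolding B1_def by (rule card_UN_le[OF finD])
  then have "real (card B1) \<le> (\<Sum>p\<in>D. real (card (case p of (i, j) \<Rightarrow> {f \<in> \<Omega>. P (f i) (f j)})))"
    unfolding of_nat_sum[symmetric] of_nat_le_iff .
  also have "\<dots> \<le> (\<Sum>p\<in>D. \<alpha> * q ^ N)"
  proof (rule sum_mono)
    fix p assume "p \<in> D"
    then obtain i j where p: "p = (i, j)" "i < N" "j < N" "i \<noteq> j" by (auto simp: D_def)
    then show "real (card (case p of (i, j) \<Rightarrow> {f \<in> \<Omega>. P (f i) (f j)})) \<le> \<alpha> * q ^ N"
      using card_tuples_pair[where I = "{..<N}" and P = P and \<alpha> = \<alpha>, of i j Q] Q pair by (simp add: \<Omega>_def q_def)
  qed
  also have "\<dots> \<le> real N ^ 2 * (\<alpha> * q ^ N)"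
    using cardD \<alpha> q by (simp add: mult_right_mono)
  finally have B1: "real (card B1) \<le> real N ^ 2 * \<alpha> * q ^ N" by simp
  have finF: "finite F" using G by (auto simp: F_def intro!: finite_PiE)
  have cardC: "real (card (C \<phi>)) \<le> M * \<beta> * q" if "\<phi> \<in> F" for \<phi>
  proof -
    have "card (C \<phi>) \<le> (\<Sum>m<M. card (A (\<phi> m)))" unfolding C_def by (rule card_UN_le) simp
    then have "real (card (C \<phi>)) \<le> (\<Sum>m<M. real (card (A (\<phi> m))))"
      unfolding of_nat_sum[symmetric] of_nat_le_iff .
    also have "\<dots> \<le> (\<Sum>m<M. \<beta> * q)"
      using that unfolding q_def by (intro sum_mono cap(2)) (auto simp: F_def)
    finally show ?thesis by simp
  qed
  have "card B2 \<le> (\<Sum>\<phi>\<in>F. card (\<Pi>\<^sub>E k\<in>{..<N}. C \<phi>))"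
    unfolding B2_def by (rule card_UN_le[OF finF])
  then have "real (card B2) \<le> (\<Sum>\<phi>\<in>F. real (card (\<Pi>\<^sub>E k\<in>{..<N}. C \<phi>)))"
    unfolding of_nat_sum[symmetric] of_nat_le_iff .
  also have "\<dots> = (\<Sum>\<phi>\<in>F. real (card (C \<phi>)) ^ N)" by (simp add: card_PiE)
  also have "\<dots> \<le> (\<Sum>\<phi>\<in>F. (M * \<beta> * q) ^ N)"
    by (intro sum_mono power_mono cardC) auto
  also have "\<dots> = real (card G) ^ M * (M * \<beta>) ^ N * q ^ N"
    by (simp add: F_def card_PiE power_mult_distrib)
  finally have B2: "real (card B2) \<le> real (card G) ^ M * (M * \<beta>) ^ N * q ^ N" .
  have "real (card (B1 \<union> B2)) \<le> real (card B1) + real (card B2)"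
    using card_Un_le[of B1 B2] by linarith
  also have "\<dots> \<le> (real N ^ 2 * \<alpha> + real (card G) ^ M * (M * \<beta>) ^ N) * q ^ N"
    using B1 B2 by (simp add: algebra_simps)
  also have "\<dots> < 1 * q ^ N" using less q by (intro mult_strict_right_mono) auto
  also have "\<dots> = real (card \<Omega>)" by (simp add: card\<Omega>)
  finally have lt: "card (B1 \<union> B2) < card \<Omega>" by simp
  have "finite (B1 \<union> B2)"
  proof -
    have "B1 \<subseteq> \<Omega>" by (auto simp: B1_def)
    moreover have "C \<phi> \<subseteq> Q" if "\<phi> \<in> F" for \<phi> using that cap(1) by (fastforce simp: C_def F_def)
    then have "B2 \<subseteq> \<Omega>" unfolding B2_def \<Omega>_def by (blast intro: PiE_mono[THEN subsetD])
    ultimately show ?thesis using fin\<Omega> by (auto intro: finite_subset)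
  qed
  then have "\<not> \<Omega> \<subseteq> B1 \<union> B2" using lt card_mono by (metis not_le)
  then obtain f where f: "f \<in> \<Omega>" "f \<notin> B1" "f \<notin> B2" by blast
  show thesis
  proof (rule that[of f])
    show "f \<in> {..<N} \<rightarrow> Q" using f(1) by (auto simp: \<Omega>_def)
    show "\<not> P (f i) (f j)" if "i < N" "j < N" "i \<noteq> j" for i j
      using f(1,2) that by (auto simp: B1_def D_def)
    fix \<Gamma> assume \<Gamma>: "\<Gamma> \<subseteq> G" "card \<Gamma> \<le> M"
    show "\<exists>i<N. \<forall>g\<in>\<Gamma>. f i \<notin> A g"
    proof (cases "\<Gamma> = {}")
      case True
      then show ?thesis using N by (auto intro: exI[of _ 0])
    next
      case False
      have fin\<Gamma>: "finite \<Gamma>" using \<Gamma> G finite_subset by blast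
      obtain h where h: "bij_betw h {..<card \<Gamma>} \<Gamma>"
        using ex_bij_betw_nat_finite[OF fin\<Gamma>] by (auto simp: atLeast0LessThan)
      have pos: "0 < card \<Gamma>" using False fin\<Gamma> by (simp add: card_gt_0_iff)
      \<comment> \<open>List \<open>\<Gamma>\<close> as \<open>M\<close> entries, repeating the first one when \<open>\<Gamma>\<close> has fewer elements.\<close>
      define \<phi> where "\<phi> = (\<lambda>m\<in>{..<M}. h (if m < card \<Gamma> then m else 0))"
      have "\<phi> \<in> F"
        using h pos \<Gamma>(1) by (auto simp: \<phi>_def F_def bij_betw_def)
      have \<Gamma>sub: "\<exists>m<M. \<phi> m = g" if g: "g \<in> \<Gamma>" for g
      proof -
        have "g \<in> h ` {..<card \<Gamma>}" using h g by (simp add: bij_betw_def)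
        then obtain m where "m < card \<Gamma>" "h m = g" by blast
        then show ?thesis using \<Gamma>(2) by (intro exI[of _ m]) (auto simp: \<phi>_def)
      qed
      have "f \<notin> (\<Pi>\<^sub>E k\<in>{..<N}. C \<phi>)" using f(3) \<open>\<phi> \<in> F\<close> by (auto simp: B2_def)
      then obtain i where i: "i < N" "f i \<notin> C \<phi>" using f(1) by (auto simp: \<Omega>_def PiE_iff)
      have "f i \<notin> A g" if "g \<in> \<Gamma>" for g
        using \<Gamma>sub[OF that] i(2) by (auto simp: C_def)
      with i(1) show ?thesis by blast
    qed
  qed
qed

text \<open>
  In terms of the unscaled sign vectors the cap has height \<open>sqrt n / 4\<close>; rounding its centre to the grid
  costs 1, whence the threshold \<open>sqrt n / 4 - 1\<close>.
\<close>

lemma exists_uncovered_family: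
  assumes n: "n \<ge> 1" "1 \<le> sqrt n / 4" and N: "N \<ge> 1"
    and less: "real N ^ 2 * (2 * exp (- n / 18)) +
      real ((2 * n + 1) ^ n) ^ M * (M * exp (- (sqrt n / 4 - 1)\<^sup>2 / 2)) ^ N < 1"
  obtains U where "cap_resistant n M U"
proof -
  define T where "T = sqrt n / 4 - 1"
  define A where "A g = {\<epsilon> \<in> signs n. T \<le> E_inner n \<epsilon> g}" for g
  have ne: "signs n \<noteq> {}" using card_signs[of n] by (metis card.empty power_not_zero zero_neq_numeral)
  have pair: "real (card {\<epsilon> \<in> signs n. n / 3 < \<bar>E_inner n \<epsilon> b\<bar>}) \<le> 2 * exp (- n / 18) * card (signs n)"
    if "b \<in> signs n" for b
    using card_signs_correlated[OF that n(1)] by (simp add: card_signs)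
  have sub: "A g \<subseteq> signs n" for g by (auto simp: A_def)
  have cap: "real (card (A g)) \<le> exp (- T\<^sup>2 / 2) * card (signs n)" if "g \<in> grid n" for g
    using card_signs_cap[of n g T] that n(2) by (simp add: A_def grid_def card_signs T_def mult.commute)
  have total: "real N ^ 2 * (2 * exp (- n / 18)) + real (card (grid n)) ^ M * (M * exp (- T\<^sup>2 / 2)) ^ N < 1"
  proof -
    have "real (card (grid n)) ^ M * (M * exp (- T\<^sup>2 / 2)) ^ N \<le>
        real ((2 * n + 1) ^ n) ^ M * (M * exp (- T\<^sup>2 / 2)) ^ N"
      using card_grid[of n] by (intro mult_right_mono power_mono) (auto simp del: of_nat_power)
    with less show ?thesis by (simp add: T_def)
  qed
  obtain f where f: "f \<in> {..<N} \<rightarrow> signs n"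
    "\<And>i j. i < N \<Longrightarrow> j < N \<Longrightarrow> i \<noteq> j \<Longrightarrow> \<not> n / 3 < \<bar>E_inner n (f i) (f j)\<bar>"
    "\<And>\<Gamma>. \<Gamma> \<subseteq> grid n \<Longrightarrow> card \<Gamma> \<le> M \<Longrightarrow> \<exists>i<N. \<forall>g\<in>\<Gamma>. f i \<notin> A g"
  proof (rule exists_separated_uncovered_tuple[OF finite_signs ne finite_grid N _ sub _ total,
        where P = "\<lambda>a b. n / 3 < \<bar>E_inner n a b\<bar>"])
    show "real (card {\<epsilon> \<in> signs n. n / 3 < \<bar>E_inner n \<epsilon> b\<bar>}) \<le> 2 * exp (- n / 18) * card (signs n)"
      if "b \<in> signs n" for b using that by (rule pair)
    show "real (card (A g)) \<le> exp (- T\<^sup>2 / 2) * card (signs n)" if "g \<in> grid n" for g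
      using that by (rule cap)
  qed (rule that)
  define u where "u i = (\<lambda>k. if k < n then f i k / sqrt n else 0)" for i
  have inner_u: "E_inner n a (u i) = E_inner n a (f i) / sqrt n"
    "E_inner n (u i) a = E_inner n (f i) a / sqrt n" for a i
    by (simp_all add: E_inner_def u_def sum_divide_distrib)
  have inner_uu: "E_inner n (u i) (u j) = E_inner n (f i) (f j) / n" for i j
    using n by (simp add: inner_u)
  have "cap_resistant n M (u ` {..<N})"
    unfolding cap_resistant_def
  proof (intro conjI ballI allI impI)
    show "u ` {..<N} \<subseteq> unit_sphere n"
    proof (rule image_subsetI)
      fix i assume "i \<in> {..<N}"
      then have "E_inner n (f i) (f i) = n" using f(1) E_inner_signs_self by blast
      moreover have "u i \<in> E_space n" by (simp add: u_def in_E_space_iff)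
      ultimately show "u i \<in> unit_sphere n" using n by (simp add: unit_sphere_iff inner_uu)
    qed
    show "\<bar>E_inner n v w\<bar> \<le> 1/3" if v: "v \<in> u ` {..<N}" and w: "w \<in> u ` {..<N}" and ne: "v \<noteq> w" for v w
    proof -
      obtain i j where ij: "v = u i" "w = u j" "i < N" "j < N" "i \<noteq> j"
        using v w ne by blast
      then have "\<bar>E_inner n (f i) (f j)\<bar> \<le> n / 3" using f(2)[of i j] by linarith
      then show ?thesis using n by (simp add: ij inner_uu abs_divide field_simps)
    qed
    fix \<Xi> assume "finite \<Xi> \<and> \<Xi> \<subseteq> unit_sphere n \<and> card \<Xi> \<le> M"
    then have \<Xi>: "finite \<Xi>" "\<Xi> \<subseteq> unit_sphere n" "card \<Xi> \<le> M" by blast+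
    have "\<forall>\<xi>\<in>\<Xi>. \<exists>g. g \<in> grid n \<and> (\<forall>\<epsilon>\<in>signs n. E_inner n \<epsilon> \<xi> - 1 \<le> E_inner n \<epsilon> g)"
      using grid_approximation[OF n(1)] \<Xi>(2) by (metis subsetD)
    then obtain r where r: "\<And>\<xi>. \<xi> \<in> \<Xi> \<Longrightarrow> r \<xi> \<in> grid n"
      "\<And>\<xi> \<epsilon>. \<xi> \<in> \<Xi> \<Longrightarrow> \<epsilon> \<in> signs n \<Longrightarrow> E_inner n \<epsilon> \<xi> - 1 \<le> E_inner n \<epsilon> (r \<xi>)"
      by metis
    have "r ` \<Xi> \<subseteq> grid n" "card (r ` \<Xi>) \<le> M"
      using r(1) \<Xi>(3) card_image_le[OF \<Xi>(1), of r] by auto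
    then obtain i where i: "i < N" "\<forall>g\<in>r ` \<Xi>. f i \<notin> A g" using f(3) by blast
    have fi: "f i \<in> signs n" using f(1) i(1) by auto
    have "E_inner n \<xi> (u i) < 1/4" if "\<xi> \<in> \<Xi>" for \<xi>
    proof -
      have "f i \<notin> A (r \<xi>)" using i(2) that by blast
      then have "E_inner n (f i) (r \<xi>) < T" using fi by (simp add: A_def)
      then have "E_inner n \<xi> (f i) < sqrt n / 4"
        using r(2)[OF that fi] by (simp add: T_def E_inner_commute[of n \<xi>])
      then show ?thesis using n by (simp add: inner_u field_simps)
    qed
    with i(1) show "\<exists>v\<in>u ` {..<N}. \<forall>\<xi>\<in>\<Xi>. E_inner n \<xi> v < 1/4" by blast
  qed
  then show thesis by (rule that)
qed

section \<open>Asymptotics and conclusion\<close>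

lemma exp_ge_inverse_cos_pi_14: "1 / cos (pi / 14) \<le> exp (27 / 1000)"
proof -
  have "sin (pi / 28) \<le> pi / 28" by (intro sin_x_le_x) simp
  moreover have "0 \<le> sin (pi / 28)" by (intro sin_ge_zero) auto
  ultimately have "(sin (pi / 28))\<^sup>2 \<le> (pi / 28)\<^sup>2" by (intro power_mono)
  also have "\<dots> \<le> (0.1125)\<^sup>2" using pi_approx by (intro power_mono) auto
  finally have "1 - 2 * (0.1125)\<^sup>2 \<le> 1 - 2 * (sin (pi / 28))\<^sup>2" by simp
  also have "\<dots> = cos (2 * (pi / 28))" by (rule cos_double_sin[symmetric])
  finally have c: "0.9746 \<le> cos (pi / 14)" by (simp add: power2_eq_square)
  have "1 \<le> 0.9746 * (1 + 27 / 1000 :: real)" by simp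
  also have "\<dots> \<le> cos (pi / 14) * exp (27 / 1000)"
    using c by (intro mult_mono exp_ge_add_one_self) auto
  finally show ?thesis using c by (simp add: pos_divide_le_eq mult.commute)
qed

text \<open>
  The rate \<open>0.027\<close> has to satisfy \<open>1 / cos (\<pi>/14) < exp 0.027\<close>, \<open>2 * 0.027 < 1/18\<close> for the pairs and
  \<open>0.027 < 1/32\<close> for the caps.
\<close>

lemma eventually_uncovered_family:
  "\<forall>\<^sub>F n in sequentially. \<exists>M U. M \<ge> 1 \<and> exp (27 / 1000 * n) \<le> real M \<and> cap_resistant n M U"
proof -
  have "(\<lambda>n. (real n ^ 2 * (exp (27 / 1000 * n) + 1)) ^ 2 * (2 * exp (- real n / 18))) \<longlonglongrightarrow> 0"
    by real_asymp
  then have ev1: "\<forall>\<^sub>F n in sequentially.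
      (real n ^ 2 * (exp (27 / 1000 * n) + 1)) ^ 2 * (2 * exp (- real n / 18)) < 1/2"
    by (rule order_tendstoD) simp
  have "(\<lambda>n. (exp (27 / 1000 * real n) + 1) *
      exp (- ((sqrt (real n) / 4 - 1) * (sqrt (real n) / 4 - 1) / 2))) \<longlonglongrightarrow> 0"
    by real_asymp
  then have "(\<lambda>n. (exp (27 / 1000 * n) + 1) * exp (- (sqrt (real n) / 4 - 1)\<^sup>2 / 2)) \<longlonglongrightarrow> 0"
    by (simp add: power2_eq_square)
  then have ev2: "\<forall>\<^sub>F n in sequentially.
      (exp (27 / 1000 * n) + 1) * exp (- (sqrt (real n) / 4 - 1)\<^sup>2 / 2) < 1/2"
    by (rule order_tendstoD) simp
  have "(\<lambda>n. (2 * real n + 1) * (1/2) ^ n) \<longlonglongrightarrow> 0" by real_asymp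
  then have ev3: "\<forall>\<^sub>F n in sequentially. (2 * real n + 1) * (1/2) ^ n < 1/2"
    by (rule order_tendstoD) simp
  show ?thesis using ev1 ev2 ev3 eventually_ge_at_top[of 16]
  proof eventually_elim
    fix n :: nat
    assume 1: "(real n ^ 2 * (exp (27 / 1000 * n) + 1)) ^ 2 * (2 * exp (- real n / 18)) < 1/2"
      and 2: "(exp (27 / 1000 * n) + 1) * exp (- (sqrt (real n) / 4 - 1)\<^sup>2 / 2) < 1/2"
      and 3: "(2 * real n + 1) * (1/2) ^ n < 1/2" and n: "16 \<le> n"
    define M where "M = nat \<lceil>exp (27 / 1000 * real n)\<rceil>"
    define N where "N = n ^ 2 * M"
    define \<beta> where "\<beta> = exp (- (sqrt (real n) / 4 - 1)\<^sup>2 / 2)"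
    have M: "exp (27 / 1000 * real n) \<le> M" "real M \<le> exp (27 / 1000 * real n) + 1"
      unfolding M_def by (rule real_nat_ceiling_ge) (simp add: of_nat_nat of_int_ceiling_le_add_one)
    have "0 < real M" using M(1) exp_gt_zero less_le_trans by blast
    then have M1: "1 \<le> M" by simp
    have N1: "1 \<le> N" using M1 n by (simp add: N_def)
    have "sqrt 16 \<le> sqrt (real n)" using n by (intro real_sqrt_le_mono) simp
    then have root: "1 \<le> sqrt (real n) / 4" by simp
    have "real N ^ 2 * (2 * exp (- real n / 18)) \<le>
        (real n ^ 2 * (exp (27 / 1000 * n) + 1)) ^ 2 * (2 * exp (- real n / 18))"
      using M(2) by (intro mult_right_mono power_mono) (auto simp: N_def intro!: mult_left_mono)
    also note 1
    finally have pairs: "real N ^ 2 * (2 * exp (- real n / 18)) < 1/2" .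
    have "M * \<beta> \<le> (exp (27 / 1000 * n) + 1) * \<beta>"
      using M(2) by (intro mult_right_mono) (auto simp: \<beta>_def)
    also note 2[folded \<beta>_def]
    finally have half: "M * \<beta> \<le> 1/2" by simp
    define x where "x = (2 * real n + 1) * (M * \<beta>) ^ n"
    have "x \<le> (2 * real n + 1) * (1/2) ^ n"
      unfolding x_def using half by (intro mult_left_mono power_mono) (auto simp: \<beta>_def)
    also note 3
    finally have x: "x < 1/2" .
    have x0: "0 \<le> x" by (simp add: x_def \<beta>_def)
    \<comment> \<open>Here \<open>N = n\<^sup>2 M\<close> is used: the factor \<open>n\<close> more than \<open>n M\<close> beats the number of grid vectors.\<close>
    have "real ((2 * n + 1) ^ n) ^ M * (M * \<beta>) ^ N = x ^ (n * M)"
      by (simp add: x_def N_def power_mult_distrib power2_eq_square mult_ac add_ac flip: power_mult)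
    also have "\<dots> \<le> x ^ 1" using x x0 M1 n by (intro power_decreasing) auto
    finally have caps: "real ((2 * n + 1) ^ n) ^ M * (M * \<beta>) ^ N < 1/2" using x by simp
    have "1 \<le> n" using n by simp
    have "real N ^ 2 * (2 * exp (- real n / 18)) + real ((2 * n + 1) ^ n) ^ M *
        (M * exp (- (sqrt (real n) / 4 - 1)\<^sup>2 / 2)) ^ N < 1"
      using pairs caps unfolding \<beta>_def by linarith
    from exists_uncovered_family[OF \<open>1 \<le> n\<close> root N1 this] obtain U where "cap_resistant n M U" .
    with M1 M(1) show "\<exists>M U. M \<ge> 1 \<and> exp (27 / 1000 * n) \<le> real M \<and> cap_resistant n M U"
      by blast
  qed
qed

theorem theorem1:
  shows "\<exists>e :: nat \<Rightarrow> real. e \<longlonglongrightarrow> 0 \<and>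
    (\<forall>n\<ge>1. cos (pi / 14) + e n > 0 \<and>
      (\<exists>K. convex_body n K \<and> constant_width n K \<and>
           real (illumination_number n K) \<ge> (cos (pi / 14) + e n) powi (- int n)))"
proof -
  define c where "c = cos (pi / 14)"
  have c: "0 < c" unfolding c_def by (intro cos_gt_zero) auto
  obtain n0 where n0: "\<And>n. n \<ge> n0 \<Longrightarrow>
      \<exists>M U. M \<ge> 1 \<and> exp (27 / 1000 * n) \<le> real M \<and> cap_resistant n M U"
    using eventually_uncovered_family unfolding eventually_sequentially by blast
  define e where "e n = (if n < n0 then 1 - c else 0)" for n
  have "e \<longlonglongrightarrow> 0"
  proof (rule tendsto_eventually)
    show "\<forall>\<^sub>F n in sequentially. e n = 0"
      using eventually_ge_at_top[of n0] by eventually_elim (simp add: e_def)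
  qed
  moreover have "\<exists>K. convex_body n K \<and> constant_width n K \<and>
      real (illumination_number n K) \<ge> (c + e n) powi (- int n)" if n: "n \<ge> 1" for n
  proof (cases "n < n0")
    case True
    obtain K where K: "convex_body n K" "constant_width n K" "0 < illumination_number n K"
      using constant_width_body_exists[OF n] .
    have "(c + e n) powi (- int n) = 1" using True by (simp add: e_def)
    then show ?thesis using K by (intro exI[of _ K]) auto
  next
    case False
    then have "n0 \<le> n" by simp
    from n0[OF this] obtain M U where MU: "M \<ge> 1" "exp (27 / 1000 * n) \<le> real M" "cap_resistant n M U"
      by blast
    obtain K where K: "convex_body n K" "constant_width n K" "M < illumination_number n K"
      using constant_width_body_of_cap_resistant[OF n MU(1,3)] .
    have "(c + e n) powi (- int n) = (1 / c) ^ n"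
      using False by (simp add: e_def power_int_minus power_divide divide_inverse power_inverse)
    also have "\<dots> \<le> exp (27 / 1000) ^ n"
      using exp_ge_inverse_cos_pi_14 c by (intro power_mono) (auto simp: c_def)
    also have "\<dots> = exp (27 / 1000 * n)" by (metis exp_of_nat_mult mult.commute)
    also have "\<dots> \<le> illumination_number n K" using MU(2) K(3) by linarith
    finally show ?thesis using K by blast
  qed
  moreover have "c + e n > 0" for n using c by (simp add: e_def)
  ultimately show ?thesis unfolding c_def[symmetric] by blast
qed

end
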